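(* Let $B$ be a simple Bratteli diagram of finite rank. If $\mu(\mathcal O_B(1))=1$, then $\mu(\mathcal P_B)=1$. If $\mu(\mathcal O_B(j))=1$ for some $j>1$, then $\mu(\mathcal P_B)=0$.
   Context: A Bratteli diagram $B$ has levels $V_n$ ($V_0=\{v_0\}$) and edge sets $E_n$ from $V_{n-1}$ to $V_n$ with source/range maps $s,r$; $X_B$ is its Cantor path space; standing assumption: $B$ aperiodic (all tail classes infinite). $B$ is simple if for every $n$ there is $m>n$ with every vertex of $V_n$ joined by a path to every vertex of $V_m$; finite rank means $\sup_n|V_n|<\infty$. An ordering $\omega$ is a linear order on each $r^{-1}(v)$, $v\ne v_0$; $\mathcal O_B=\prod_v P_v$ carries the product measure $\mu=\prod_v\mu_v$, $\mu_v$ uniform on the set $P_v$ of linear orders of $r^{-1}(v)$. $\mathcal O_B(j)$: orderings with exactly $j$ maximal infinite paths. $\omega$ is perfect ($\omega\in\mathcal P_B$) if it admits a Vershik map: a homeomorphism of $X_B$ sending the maximal infinite paths onto the minimal ones and sending each non-maximal $x$ to the path obtained by replacing its first non-maximal edge $x_k$ by its successor $\overline{x_k}$ in $r^{-1}(r(x_k))$ and $(x_1,\dots,x_{k-1})$ by the minimal path from $v_0$ to $s(\overline{x_k})$. *)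

theory Defs
  imports "HOL-Probability.Probability"
begin

text \<open>Bratteli diagram encoding.  Vertex levels V n (n \<ge> 0), edge levels E n (n \<ge> 0),
  where the edges in E n go from V n to V (Suc n); source and range maps are
  level-indexed: s n, r n.  (The paper's E_{n+1} is our E n.)\<close>

definition bratteli ::
  "(nat \<Rightarrow> 'v set) \<Rightarrow> (nat \<Rightarrow> 'e set) \<Rightarrow> (nat \<Rightarrow> 'e \<Rightarrow> 'v) \<Rightarrow> (nat \<Rightarrow> 'e \<Rightarrow> 'v) \<Rightarrow> 'v \<Rightarrow> bool" where
  "bratteli V E s r v0 \<longleftrightarrow>
     V 0 = {v0} \<and>
     (\<forall>n. finite (V n) \<and> V n \<noteq> {} \<and> finite (E n)) \<and>
     (\<forall>n. \<forall>e\<in>E n. s n e \<in> V n \<and> r n e \<in> V (Suc n)) \<and>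
     (\<forall>n. \<forall>v\<in>V (Suc n). \<exists>e\<in>E n. r n e = v) \<and>
     (\<forall>n. \<forall>v\<in>V n. \<exists>e\<in>E n. s n e = v)"

definition path_space :: "(nat \<Rightarrow> 'e set) \<Rightarrow> (nat \<Rightarrow> 'e \<Rightarrow> 'v) \<Rightarrow> (nat \<Rightarrow> 'e \<Rightarrow> 'v) \<Rightarrow> (nat \<Rightarrow> 'e) set" where
  "path_space E s r = {x. \<forall>n. x n \<in> E n \<and> r n (x n) = s (Suc n) (x (Suc n))}"

definition fin_path ::
  "(nat \<Rightarrow> 'e set) \<Rightarrow> (nat \<Rightarrow> 'e \<Rightarrow> 'v) \<Rightarrow> (nat \<Rightarrow> 'e \<Rightarrow> 'v) \<Rightarrow> nat \<Rightarrow> nat \<Rightarrow> 'v \<Rightarrow> 'v \<Rightarrow> (nat \<Rightarrow> 'e) \<Rightarrow> bool" where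
  "fin_path E s r n m v w p \<longleftrightarrow> n < m \<and>
     (\<forall>i. n \<le> i \<and> i < m \<longrightarrow> p i \<in> E i) \<and>
     s n (p n) = v \<and> r (m - 1) (p (m - 1)) = w \<and>
     (\<forall>i. n \<le> i \<and> Suc i < m \<longrightarrow> r i (p i) = s (Suc i) (p (Suc i)))"

definition simple_bratteli ::
  "(nat \<Rightarrow> 'v set) \<Rightarrow> (nat \<Rightarrow> 'e set) \<Rightarrow> (nat \<Rightarrow> 'e \<Rightarrow> 'v) \<Rightarrow> (nat \<Rightarrow> 'e \<Rightarrow> 'v) \<Rightarrow> bool" where
  "simple_bratteli V E s r \<longleftrightarrow>
     (\<forall>n. \<exists>m>n. \<forall>v\<in>V n. \<forall>w\<in>V m. \<exists>p. fin_path E s r n m v w p)"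

definition finite_rank :: "(nat \<Rightarrow> 'v set) \<Rightarrow> bool" where
  "finite_rank V \<longleftrightarrow> (\<exists>K. \<forall>n. card (V n) \<le> K)"

text \<open>Standing assumption: every tail-equivalence class is infinite.\<close>
definition aperiodic :: "(nat \<Rightarrow> 'e set) \<Rightarrow> (nat \<Rightarrow> 'e \<Rightarrow> 'v) \<Rightarrow> (nat \<Rightarrow> 'e \<Rightarrow> 'v) \<Rightarrow> bool" where
  "aperiodic E s r \<longleftrightarrow>
     (\<forall>x\<in>path_space E s r. infinite {y\<in>path_space E s r. \<exists>N. \<forall>n\<ge>N. y n = x n})"

text \<open>Orderings: for each vertex v \<in> V (Suc n) (i.e. v \<noteq> v0), a linear order of
  r^{-1}(v), represented as a duplicate-free list enumerating r^{-1}(v) in increasing order.\<close>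
definition local_orders :: "(nat \<Rightarrow> 'e set) \<Rightarrow> (nat \<Rightarrow> 'e \<Rightarrow> 'v) \<Rightarrow> nat \<Rightarrow> 'v \<Rightarrow> 'e list set" where
  "local_orders E r n v = {l. distinct l \<and> set l = {e\<in>E n. r n e = v}}"

definition ord_measure ::
  "(nat \<Rightarrow> 'v set) \<Rightarrow> (nat \<Rightarrow> 'e set) \<Rightarrow> (nat \<Rightarrow> 'e \<Rightarrow> 'v) \<Rightarrow> (nat \<times> 'v \<Rightarrow> 'e list) measure" where
  "ord_measure V E r =
     PiM (SIGMA n:UNIV. V (Suc n)) (\<lambda>(n, v). uniform_count_measure (local_orders E r n v))"

definition max_paths ::
  "(nat \<Rightarrow> 'e set) \<Rightarrow> (nat \<Rightarrow> 'e \<Rightarrow> 'v) \<Rightarrow> (nat \<Rightarrow> 'e \<Rightarrow> 'v) \<Rightarrow> (nat \<times> 'v \<Rightarrow> 'e list) \<Rightarrow> (nat \<Rightarrow> 'e) set" where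
  "max_paths E s r \<omega> = {x\<in>path_space E s r. \<forall>n. x n = last (\<omega> (n, r n (x n)))}"

definition min_paths ::
  "(nat \<Rightarrow> 'e set) \<Rightarrow> (nat \<Rightarrow> 'e \<Rightarrow> 'v) \<Rightarrow> (nat \<Rightarrow> 'e \<Rightarrow> 'v) \<Rightarrow> (nat \<times> 'v \<Rightarrow> 'e list) \<Rightarrow> (nat \<Rightarrow> 'e) set" where
  "min_paths E s r \<omega> = {x\<in>path_space E s r. \<forall>n. x n = hd (\<omega> (n, r n (x n)))}"

definition succ_edge :: "(nat \<Rightarrow> 'e \<Rightarrow> 'v) \<Rightarrow> (nat \<times> 'v \<Rightarrow> 'e list) \<Rightarrow> nat \<Rightarrow> 'e \<Rightarrow> 'e" where
  "succ_edge r \<omega> n e =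
     (THE e'. \<exists>i. Suc i < length (\<omega> (n, r n e)) \<and> \<omega> (n, r n e) ! i = e \<and> \<omega> (n, r n e) ! Suc i = e')"

definition vershik_step ::
  "(nat \<Rightarrow> 'e set) \<Rightarrow> (nat \<Rightarrow> 'e \<Rightarrow> 'v) \<Rightarrow> (nat \<Rightarrow> 'e \<Rightarrow> 'v) \<Rightarrow> (nat \<times> 'v \<Rightarrow> 'e list)
    \<Rightarrow> (nat \<Rightarrow> 'e) \<Rightarrow> (nat \<Rightarrow> 'e) \<Rightarrow> bool" where
  "vershik_step E s r \<omega> x y \<longleftrightarrow>
     (let k = (LEAST k. x k \<noteq> last (\<omega> (k, r k (x k)))) in
        y \<in> path_space E s r \<and>
        (\<forall>i<k. y i = hd (\<omega> (i, r i (y i)))) \<and>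
        y k = succ_edge r \<omega> k (x k) \<and>
        (\<forall>i>k. y i = x i))"

definition path_topology :: "(nat \<Rightarrow> 'e) set \<Rightarrow> (nat \<Rightarrow> 'e) topology" where
  "path_topology X = subtopology (product_topology (\<lambda>_::nat. discrete_topology (UNIV::'e set)) UNIV) X"

definition perfect_ordering ::
  "(nat \<Rightarrow> 'e set) \<Rightarrow> (nat \<Rightarrow> 'e \<Rightarrow> 'v) \<Rightarrow> (nat \<Rightarrow> 'e \<Rightarrow> 'v) \<Rightarrow> (nat \<times> 'v \<Rightarrow> 'e list) \<Rightarrow> bool" where
  "perfect_ordering E s r \<omega> \<longleftrightarrow>
     (\<exists>\<phi>. homeomorphic_map (path_topology (path_space E s r)) (path_topology (path_space E s r)) \<phi> \<and>
          \<phi> ` max_paths E s r \<omega> = min_paths E s r \<omega> \<and>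
          (\<forall>x\<in>path_space E s r - max_paths E s r \<omega>. vershik_step E s r \<omega> x (\<phi> x)))"

definition orderings_with_max ::
  "(nat \<Rightarrow> 'v set) \<Rightarrow> (nat \<Rightarrow> 'e set) \<Rightarrow> (nat \<Rightarrow> 'e \<Rightarrow> 'v) \<Rightarrow> (nat \<Rightarrow> 'e \<Rightarrow> 'v) \<Rightarrow> nat
     \<Rightarrow> (nat \<times> 'v \<Rightarrow> 'e list) set" where
  "orderings_with_max V E s r j =
     {\<omega>\<in>space (ord_measure V E r). finite (max_paths E s r \<omega>) \<and> card (max_paths E s r \<omega>) = j}"

definition perfect_orderings ::
  "(nat \<Rightarrow> 'v set) \<Rightarrow> (nat \<Rightarrow> 'e set) \<Rightarrow> (nat \<Rightarrow> 'e \<Rightarrow> 'v) \<Rightarrow> (nat \<Rightarrow> 'e \<Rightarrow> 'v)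
     \<Rightarrow> (nat \<times> 'v \<Rightarrow> 'e list) set" where
  "perfect_orderings V E s r = {\<omega>\<in>space (ord_measure V E r). perfect_ordering E s r \<omega>}"

end

theory Submission
  imports Defs "HOL-Combinatorics.Transposition"
begin

text \<open>Reversing all local orders preserves the measure and exchanges maximal and minimal paths.  So if
  almost every ordering has one maximal path, almost every ordering also has one minimal path, and then
  the Vershik map, completed by sending the one to the other, is a homeomorphism by compactness.

  Suppose now that an ordering with two maximal paths has a Vershik map \<open>\<phi>\<close>, and let \<open>c\<close> be a coordinate
  in which the images of these paths differ.  By uniform continuity \<open>\<phi> x c\<close> depends only on an initial
  segment of \<open>x\<close>.  Hence each vertex \<open>u\<close> of a high level has two labels: \<open>F u\<close> is the value of \<open>\<phi> x c\<close> when
  \<open>x\<close> enters \<open>u\<close> along the maximal path, and \<open>G u\<close> is \<open>y c\<close> when \<open>y\<close> enters \<open>u\<close> along the minimal path.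
  If \<open>e'\<close> succeeds \<open>e\<close> in the order at some vertex, then \<open>F (s e) = G (s e')\<close>, while \<open>F\<close> takes two values
  on each level.  Given the orders below a vertex, either every order there satisfies this condition or
  at least half of the orders violate it, since a transposition of two suitable edges maps the
  admissible orders injectively to inadmissible ones.  By simplicity the second case occurs within
  every sufficiently long window of levels, so the condition survives \<open>k\<close> windows with probability at
  most \<open>2\<^sup>-\<^sup>k\<close>.\<close>

section \<open>Products of uniform measures\<close>

text \<open>The preimage of a cylinder is a cylinder whose sides have the same cardinalities,
  because each \<open>f i\<close> is a bijection, and cylinders determine the product measure. It
  serves twice: for the reversal of all orders and for a transposition at one vertex.\<close>

lemma distr_PiM_uniform_bij:
  assumes fin: "\<And>i. i \<in> I \<Longrightarrow> finite (A i)" and ne: "\<And>i. i \<in> I \<Longrightarrow> A i \<noteq> {}"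
    and bij: "\<And>i. i \<in> I \<Longrightarrow> bij_betw (f i) (A i) (A i)"
  defines "M \<equiv> PiM I (\<lambda>i. uniform_count_measure (A i))"
  shows "(\<lambda>\<omega>. \<lambda>i\<in>I. f i (\<omega> i)) \<in> measurable M M"
    and "distr M M (\<lambda>\<omega>. \<lambda>i\<in>I. f i (\<omega> i)) = M"
proof -
  let ?U = "\<lambda>i. uniform_count_measure (A i)" and ?T = "\<lambda>\<omega>. \<lambda>i\<in>I. f i (\<omega> i)"
  have prob: "prob_space (?U i)" if "i \<in> I" for i
    using fin ne that by (intro prob_space_uniform_count_measure) auto
  have maps: "f i \<in> A i \<rightarrow> A i" if "i \<in> I" for i
    using bij[OF that] by (auto simp: bij_betw_def)
  show T: "?T \<in> measurable M M"
    unfolding M_def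
  proof (rule measurable_restrict)
    fix i assume i: "i \<in> I"
    have "f i \<in> measurable (?U i) (?U i)"
      using maps[OF i] by (auto simp: measurable_def space_uniform_count_measure sets_uniform_count_measure)
    then show "(\<lambda>\<omega>. f i (\<omega> i)) \<in> measurable (PiM I ?U) (?U i)"
      by (rule measurable_compose[OF measurable_component_singleton[OF i]])
  qed
  interpret P: prob_space M
    unfolding M_def using prob by (rule prob_space_PiM)
  have sp: "space M = PiE I A"
    by (simp add: M_def space_PiM space_uniform_count_measure)
  show "distr M M ?T = M"
    unfolding M_def
  proof (rule measure_eqI_PiM_infinite)
    show "finite_measure (distr (PiM I ?U) (PiM I ?U) ?T)"
      using P.prob_space_distr[OF T] unfolding M_def by (simp add: prob_space.finite_measure)
  next
    fix X J assume J: "finite J" "J \<subseteq> I" and X: "\<And>i. i \<in> J \<Longrightarrow> X i \<in> sets (?U i)"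
    let ?Y = "\<lambda>i. f i -` X i \<inter> A i"
    have XA: "X i \<subseteq> A i" if "i \<in> J" for i
      using X[OF that] by (simp add: sets_uniform_count_measure)
    have pre: "?T -` prod_emb I ?U J (PiE J X) \<inter> space M = prod_emb I ?U J (PiE J ?Y)"
    proof -
      have "(?T \<omega> \<in> prod_emb I ?U J (PiE J X)) = (\<omega> \<in> prod_emb I ?U J (PiE J ?Y))" if w: "\<omega> \<in> space M" for \<omega>
      proof -
        have "?T \<omega> \<in> PiE I A" using w maps by (auto simp: sp PiE_iff)
        then show ?thesis
          using w J by (auto simp: prod_emb_def sp space_uniform_count_measure PiE_iff)
      qed
      moreover have "prod_emb I ?U J (PiE J ?Y) \<subseteq> space M"
        by (auto simp: prod_emb_def sp space_uniform_count_measure)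
      ultimately show ?thesis by blast
    qed
    have card: "emeasure (?U i) (?Y i) = emeasure (?U i) (X i)" if "i \<in> J" for i
    proof -
      have i: "i \<in> I" using that J by auto
      have "f i ` ?Y i = X i \<inter> f i ` A i" by blast
      also have "\<dots> = X i" using XA[OF that] bij_betw_imp_surj_on[OF bij[OF i]] by auto
      finally have "f i ` ?Y i = X i" .
      moreover have "inj_on (f i) (?Y i)"
        using bij[OF i] by (auto simp: bij_betw_def intro: inj_on_subset)
      ultimately have "card (?Y i) = card (X i)" by (metis card_image)
      then show ?thesis
        using XA[OF that] fin[OF i] by (simp add: emeasure_uniform_count_measure)
    qed
    have "emeasure (distr (PiM I ?U) (PiM I ?U) ?T) (prod_emb I ?U J (PiE J X))
        = emeasure M (prod_emb I ?U J (PiE J ?Y))"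
      using T J X by (subst emeasure_distr) (auto simp: pre[unfolded M_def] M_def intro!: sets_PiM_I)
    also have "\<dots> = (\<Prod>i\<in>J. emeasure (?U i) (?Y i))"
      unfolding M_def using J prob by (intro emeasure_PiM_emb) (auto simp: sets_uniform_count_measure)
    also have "\<dots> = (\<Prod>i\<in>J. emeasure (?U i) (X i))"
      by (intro prod.cong) (auto simp: card)
    also have "\<dots> = emeasure (PiM I ?U) (prod_emb I ?U J (PiE J X))"
      using J X prob by (intro emeasure_PiM_emb[symmetric]) auto
    finally show "emeasure (distr (PiM I ?U) (PiM I ?U) ?T) (prod_emb I ?U J (PiE J X))
        = emeasure (PiM I ?U) (prod_emb I ?U J (PiE J X))" .
  qed simp_all
qed

text \<open>Such a set is the union of the cylinders obtained by fixing the coordinates in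
  \<open>J\<close>, and only finitely many restrictions to \<open>J\<close> occur.\<close>

lemma sets_PiM_uniform_finite_support:
  assumes J: "finite J" "J \<subseteq> I" and fin: "\<And>i. i \<in> J \<Longrightarrow> finite (A i)"
    and S: "S \<subseteq> PiE I A"
    and dep: "\<And>\<omega> \<omega>'. \<omega> \<in> S \<Longrightarrow> \<omega>' \<in> PiE I A \<Longrightarrow> (\<And>i. i \<in> J \<Longrightarrow> \<omega>' i = \<omega> i) \<Longrightarrow> \<omega>' \<in> S"
  shows "S \<in> sets (PiM I (\<lambda>i. uniform_count_measure (A i)))"
proof -
  let ?U = "\<lambda>i. uniform_count_measure (A i)"
  let ?R = "(\<lambda>\<omega>. restrict \<omega> J) ` S"
  have RA: "?R \<subseteq> PiE J A"
    using S J by (fastforce simp: PiE_iff)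
  then have R: "finite ?R" using J fin by (meson finite_PiE finite_subset)
  have "S = (\<Union>\<eta>\<in>?R. prod_emb I ?U J (PiE J (\<lambda>i. {\<eta> i})))"
  proof (intro equalityI subsetI)
    fix \<omega> assume "\<omega> \<in> S"
    then have "\<omega> \<in> prod_emb I ?U J (PiE J (\<lambda>i. {restrict \<omega> J i}))"
      using S by (auto simp: prod_emb_def space_uniform_count_measure PiE_iff)
    with \<open>\<omega> \<in> S\<close> show "\<omega> \<in> (\<Union>\<eta>\<in>?R. prod_emb I ?U J (PiE J (\<lambda>i. {\<eta> i})))" by blast
  next
    fix \<omega>' assume "\<omega>' \<in> (\<Union>\<eta>\<in>?R. prod_emb I ?U J (PiE J (\<lambda>i. {\<eta> i})))"
    then obtain \<omega> where w: "\<omega> \<in> S" "\<omega>' \<in> prod_emb I ?U J (PiE J (\<lambda>i. {restrict \<omega> J i}))" by auto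
    then show "\<omega>' \<in> S"
      by (intro dep[OF w(1)]) (auto simp: prod_emb_def space_uniform_count_measure PiE_iff split: if_splits)
  qed
  also have "\<dots> \<in> sets (PiM I ?U)"
  proof (rule sets.finite_UN[OF R])
    fix \<eta> assume "\<eta> \<in> ?R"
    then have "\<forall>i\<in>J. \<eta> i \<in> A i" using \<open>\<eta> \<in> ?R\<close> RA by blast
    then have "\<forall>i\<in>J. {\<eta> i} \<in> sets (?U i)"
      by (simp add: sets_uniform_count_measure)
    then show "prod_emb I ?U J (PiE J (\<lambda>i. {\<eta> i})) \<in> sets (PiM I ?U)"
      using J by (intro sets_PiM_I) auto
  qed
  finally show ?thesis .
qed

text \<open>The fibres of \<open>key\<close> partition \<open>A\<close>, and each is carried into
  \<open>D - A\<close> by its own measure-preserving involution. The key survives the move, so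
  images of different fibres are disjoint and \<open>D - A\<close> is at least as large as
  \<open>A\<close>.\<close>

lemma (in finite_measure) measure_le_half_by_involutions:
  assumes "finite K" and AD: "A \<in> sets M" "D \<in> sets M" "A \<subseteq> D"
    and meas: "\<And>t. t \<in> K \<Longrightarrow> \<tau> t \<in> measurable M M"
    and pres: "\<And>t. t \<in> K \<Longrightarrow> distr M M (\<tau> t) = M"
    and invol: "\<And>t \<omega>. t \<in> K \<Longrightarrow> \<omega> \<in> space M \<Longrightarrow> \<tau> t (\<tau> t \<omega>) = \<omega>"
    and fibre: "\<And>t. t \<in> K \<Longrightarrow> {\<omega> \<in> A. key \<omega> = t} \<in> sets M"
    and key: "\<And>\<omega>. \<omega> \<in> A \<Longrightarrow> key \<omega> \<in> K"
    and key_inv: "\<And>\<omega>. \<omega> \<in> A \<Longrightarrow> key (\<tau> (key \<omega>) \<omega>) = key \<omega>"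
    and moves: "\<And>\<omega>. \<omega> \<in> A \<Longrightarrow> \<tau> (key \<omega>) \<omega> \<in> D - A"
  shows "2 * measure M A \<le> measure M D"
proof -
  let ?F = "\<lambda>t. {\<omega> \<in> A. key \<omega> = t}"
  let ?G = "\<lambda>t. \<tau> t -` ?F t \<inter> space M"
  have G: "?G t \<in> sets M" if "t \<in> K" for t
    using meas[OF that] fibre[OF that] by (rule measurable_sets)
  have FG: "measure M (?G t) = measure M (?F t)" if "t \<in> K" for t
    using measure_distr[OF meas[OF that] fibre[OF that]] pres[OF that] by simp
  have inv_fibre: "\<omega> \<in> D - A \<and> key \<omega> = t" if "t \<in> K" "\<omega> \<in> ?G t" for t \<omega>
    using that invol[of t \<omega>] moves[of "\<tau> t \<omega>"] key_inv[of "\<tau> t \<omega>"] by auto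
  have "A = (\<Union>t\<in>K. ?F t)" using key by auto
  then have "measure M A = measure M (\<Union>t\<in>K. ?F t)" by simp
  also have "\<dots> = (\<Sum>t\<in>K. measure M (?F t))"
    using fibre by (intro finite_measure_finite_Union[OF \<open>finite K\<close>]) (auto simp: disjoint_family_on_def)
  also have "\<dots> = (\<Sum>t\<in>K. measure M (?G t))"
    by (rule sum.cong[OF refl], rule FG[symmetric])
  also have "\<dots> = measure M (\<Union>t\<in>K. ?G t)"
  proof (rule finite_measure_finite_Union[OF \<open>finite K\<close>, symmetric])
    have "\<omega> \<notin> ?G u" if "t \<in> K" "u \<in> K" "t \<noteq> u" "\<omega> \<in> ?G t" for t u \<omega>
      using inv_fibre[OF that(1,4)] inv_fibre[OF that(2), of \<omega>] that(3) by metis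
    then show "disjoint_family_on ?G K"
      unfolding disjoint_family_on_def by blast
  qed (use G in auto)
  also have "\<dots> \<le> measure M (D - A)"
  proof (rule finite_measure_mono)
    show "(\<Union>t\<in>K. ?G t) \<subseteq> D - A" using inv_fibre by blast
  qed (use AD in auto)
  also have "\<dots> = measure M D - measure M A"
    using AD by (intro finite_measure_Diff) auto
  finally show ?thesis by simp
qed

section \<open>Matching lists\<close>

text \<open>In the application \<open>f\<close> and \<open>g\<close> read the labels
  \<open>F\<close> and \<open>G\<close> at the source of an edge, so this is the constraint that a
  Vershik map puts on a local order.\<close>

definition matching :: "('e \<Rightarrow> 'c) \<Rightarrow> ('e \<Rightarrow> 'c) \<Rightarrow> 'e list \<Rightarrow> bool" where
  "matching f g l \<longleftrightarrow> (\<forall>i. Suc i < length l \<longrightarrow> f (l ! i) = g (l ! Suc i))"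

text \<open>Reversal exchanges predecessors and successors; it reduces the case of edges told apart
  by \<open>g\<close> to that of edges told apart by \<open>f\<close>.\<close>

lemma matching_rev: "matching g f (rev l) \<longleftrightarrow> matching f g l"
proof -
  have *: "matching g f (rev l)" if m: "matching f g l" for f g :: "'a \<Rightarrow> 'b" and l
    unfolding matching_def
  proof (intro allI impI)
    fix i assume i: "Suc i < length (rev l)"
    define j where "j = length l - Suc (Suc i)"
    have "rev l ! i = l ! Suc j" "rev l ! Suc i = l ! j" "Suc j < length l"
      using i by (auto simp: rev_nth j_def Suc_diff_Suc)
    then show "g (rev l ! i) = f (rev l ! Suc i)"
      using m by (simp add: matching_def)
  qed
  show ?thesis using *[of f g l] *[of g f "rev l"] by auto
qed

text \<open>A successor that the transposition fixes would have to match both \<open>f e1\<close>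
  and \<open>f e2\<close>. If the moved entries are the last two of the list, their predecessor is
  used instead; length at least 3 provides it.\<close>

lemma not_matching_transpose:
  assumes l: "distinct l" "3 \<le> length l" and m: "matching f g l"
    and e: "e1 \<in> set l" "e2 \<in> set l" "f e1 \<noteq> f e2"
  shows "\<not> matching f g (map (Transposition.transpose e1 e2) l)"
proof
  assume m': "matching f g (map (Transposition.transpose e1 e2) l)"
  obtain i j where ij: "i < j" "j < length l" "f (l ! i) \<noteq> f (l ! j)"
      and tr: "Transposition.transpose e1 e2 = Transposition.transpose (l ! i) (l ! j)"
  proof -
    obtain i j where ij: "i < length l" "j < length l" "l ! i = e1" "l ! j = e2"
      using e by (auto simp: in_set_conv_nth)
    have "i \<noteq> j" using ij e by auto
    then consider "i < j" | "j < i" by linarith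
    then show ?thesis
      by cases (use ij e that[of i j] that[of j i] in \<open>auto simp: transpose_commute\<close>)
  qed
  let ?t = "Transposition.transpose (l ! i) (l ! j)"
  have M: "Suc k < length l \<Longrightarrow> f (l ! k) = g (l ! Suc k)" for k
    using m by (simp add: matching_def)
  have M': "Suc k < length l \<Longrightarrow> f (?t (l ! k)) = g (?t (l ! Suc k))" for k
    using m' by (simp add: matching_def tr)
  have fix': "?t (l ! k) = l ! k" if "k < length l" "k \<noteq> i" "k \<noteq> j" for k
    using that l ij by (auto simp: transpose_def nth_eq_iff_index_eq)
  consider "Suc i < j" | "j = Suc i" "Suc j < length l" | "j = Suc i" "length l = Suc j" "0 < i"
    using ij l by linarith
  then show False
  proof cases
    case 1
    then show False using M[of i] M'[of i] fix'[of "Suc i"] ij by auto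
  next
    case 2
    then show False using M[of j] M'[of j] fix'[of "Suc j"] ij by auto
  next
    \<comment> \<open>The predecessor of the pair gives \<open>g (l ! i) = g (l ! j)\<close>, and
      the two matchings across the pair then give \<open>f (l ! i) = f (l ! j)\<close>.\<close>
    case 3
    then show False
      using M[of i] M'[of i] M[of "i - 1"] M'[of "i - 1"] fix'[of "i - 1"] ij by auto
  qed
qed

lemma distinct_set_pair:
  assumes "distinct l" "set l = {a, b}" "a \<noteq> b"
  shows "l = [a, b] \<or> l = [b, a]"
proof -
  have "length l = 2" using assms distinct_card[of l] by simp
  then obtain x y where "l = [x, y]" by (auto simp: numeral_2_eq_2 length_Suc_conv)
  then show ?thesis using assms by (auto simp: doubleton_eq_iff)
qed

text \<open>One transposition must serve every matching order of the same edges. With two edges it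
  exchanges the only two orders, one of which is bad; with more, it exchanges edges that
  \<open>f\<close> or \<open>g\<close> tells apart; if both functions are constant, no order matches
  at all.\<close>

lemma ex_transpose_not_matching:
  assumes l0: "distinct l0" "\<not> matching f g l0"
  shows "\<exists>e1\<in>set l0. \<exists>e2\<in>set l0. \<forall>l. distinct l \<longrightarrow> set l = set l0 \<longrightarrow> matching f g l
           \<longrightarrow> \<not> matching f g (map (Transposition.transpose e1 e2) l)"
proof -
  obtain i where i: "Suc i < length l0" "f (l0 ! i) \<noteq> g (l0 ! Suc i)"
    using l0 by (auto simp: matching_def)
  define a b where "a = l0 ! i" and "b = l0 ! Suc i"
  have ab: "a \<in> set l0" "b \<in> set l0" "a \<noteq> b" "f a \<noteq> g b"
    using i l0 by (auto simp: a_def b_def nth_eq_iff_index_eq)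
  have len: "length l = length l0" if "distinct l" "set l = set l0" for l
    using that l0 by (metis distinct_card)
  have "length l0 = 2 \<or> 3 \<le> length l0" using i by linarith
  then consider (two) "length l0 = 2" | (f) e1 e2 where "3 \<le> length l0" "e1 \<in> set l0" "e2 \<in> set l0" "f e1 \<noteq> f e2"
    | (g) e1 e2 where "3 \<le> length l0" "e1 \<in> set l0" "e2 \<in> set l0" "g e1 \<noteq> g e2"
    | (const) "\<forall>e1\<in>set l0. \<forall>e2\<in>set l0. f e1 = f e2 \<and> g e1 = g e2" "3 \<le> length l0"
    by blast
  then show ?thesis
  proof cases
    case two
    then have "i = 0" using i by simp
    with two have l0_eq: "l0 = [a, b]"
      by (auto simp: a_def b_def intro!: nth_equalityI simp: less_Suc_eq numeral_2_eq_2)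
    have bad: "\<not> matching f g [a, b]" using ab by (simp add: matching_def)
    have "\<not> matching f g (map (Transposition.transpose a b) l)"
      if "distinct l" "set l = set l0" "matching f g l" for l
      using distinct_set_pair[of l a b] that ab bad l0_eq by auto
    then show ?thesis using ab by blast
  next
    case f
    then show ?thesis using not_matching_transpose[of _ f g e1 e2] len by metis
  next
    case g
    have "\<not> matching f g (map (Transposition.transpose e1 e2) l)"
      if "distinct l" "set l = set l0" "matching f g l" for l
      using not_matching_transpose[of "rev l" g f e1 e2] g len[of l] that
      by (simp add: matching_rev rev_map[symmetric])
    then show ?thesis using g by blast
  next
    case const
    have "\<not> matching f g l" if "distinct l" "set l = set l0" for l
    proof -
      have "l ! 0 \<in> set l" "l ! 1 \<in> set l" "Suc 0 < length l"
        using const len[of l] that by (auto intro!: nth_mem)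
      moreover from this have "f (l ! 0) = f a" "g (l ! 1) = g b" using const that ab by metis+
      ultimately show ?thesis using ab by (auto simp: matching_def)
    qed
    then show ?thesis using ab by blast
  qed
qed

section \<open>Topology of path spaces\<close>

lemma topspace_path_topology [simp]: "topspace (path_topology P) = P"
  by (simp add: path_topology_def)

text \<open>Cylinders over initial segments form a base of the topology; later arguments use only
  this elementary form.\<close>

lemma openin_path_topology:
  "openin (path_topology P) U \<longleftrightarrow> U \<subseteq> P \<and> (\<forall>x\<in>U. \<exists>n. \<forall>y\<in>P. (\<forall>i<n. y i = x i) \<longrightarrow> y \<in> U)"
  (is "_ \<longleftrightarrow> ?R")
proof
  let ?X = "product_topology (\<lambda>_::nat. discrete_topology (UNIV::'a set)) UNIV"
  assume "openin (path_topology P) U"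
  then obtain T where T: "openin ?X T" "U = T \<inter> P"
    by (auto simp: path_topology_def openin_subtopology)
  have "\<exists>n. \<forall>y\<in>P. (\<forall>i<n. y i = x i) \<longrightarrow> y \<in> U" if "x \<in> U" for x
  proof -
    have "x \<in> T" using T that by blast
    from T(1)[unfolded openin_product_topology_alt, rule_format, OF this]
    obtain W where W: "finite {i. W i \<noteq> (UNIV::'a set)}" "x \<in> PiE UNIV W" "PiE UNIV W \<subseteq> T"
      by (auto simp del: PiE_UNIV_domain)
    obtain n where n: "\<And>i. W i \<noteq> UNIV \<Longrightarrow> i < n"
      using W(1) unfolding finite_nat_set_iff_bounded by auto
    have "y \<in> U" if "y \<in> P" "\<forall>i<n. y i = x i" for y
    proof -
      have "y i \<in> W i" for i
        using n[of i] that W(2) by (cases "W i = UNIV") (auto simp: PiE_iff)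
      then show ?thesis using W T that by (auto simp: PiE_iff)
    qed
    then show ?thesis by blast
  qed
  then show ?R using T by blast
next
  let ?X = "product_topology (\<lambda>_::nat. discrete_topology (UNIV::'a set)) UNIV"
  assume R: ?R
  then obtain n where n: "\<And>x y. x \<in> U \<Longrightarrow> y \<in> P \<Longrightarrow> (\<forall>i<n x. y i = x i) \<Longrightarrow> y \<in> U"
    by metis
  let ?C = "\<lambda>x. {y. \<forall>i<n x. y i = x i}"
  have "openin ?X (?C x)" for x
    unfolding openin_product_topology_alt
  proof
    fix y assume y: "y \<in> ?C x"
    have "finite {i \<in> UNIV. (if i < n x then {x i} else UNIV) \<noteq> topspace (discrete_topology (UNIV::'a set))}"
      by (rule finite_subset[of _ "{..<n x}"]) auto
    with y show "\<exists>W. finite {i \<in> UNIV. W i \<noteq> topspace (discrete_topology (UNIV::'a set))} \<and>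
        (\<forall>i\<in>UNIV. openin (discrete_topology UNIV) (W i)) \<and> y \<in> PiE UNIV W \<and> PiE UNIV W \<subseteq> ?C x"
      by (intro exI[of _ "\<lambda>i. if i < n x then {x i} else UNIV"] conjI) (auto simp: PiE_iff split: if_splits)
  qed
  then have "openin ?X (\<Union>x\<in>U. ?C x)" by blast
  moreover have "U = (\<Union>x\<in>U. ?C x) \<inter> P" using R n by auto
  ultimately show "openin (path_topology P) U"
    by (auto simp: path_topology_def openin_subtopology)
qed

lemma Hausdorff_space_path_topology: "Hausdorff_space (path_topology P)"
  unfolding path_topology_def
  by (intro Hausdorff_space_subtopology)
    (simp add: Hausdorff_space_product_topology Hausdorff_space_discrete_topology)

text \<open>The product of the finite sets \<open>E n\<close> is compact, and failure to be a path
  is visible in two consecutive coordinates, so the paths form a closed subset of it.\<close>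

lemma compact_space_path_space:
  assumes "\<And>n. finite (E n)"
  shows "compact_space (path_topology (path_space E s r))"
proof -
  let ?X = "product_topology (\<lambda>_::nat. discrete_topology (UNIV::'a set)) UNIV"
  have X: "?X = path_topology UNIV" by (simp add: path_topology_def)
  have "compactin ?X (PiE UNIV E)"
    using assms by (simp add: compactin_PiE compactin_discrete_topology)
  moreover have "path_space E s r \<subseteq> PiE UNIV E"
    by (auto simp: path_space_def)
  moreover have "closedin ?X (path_space E s r)"
    unfolding X closedin_def openin_path_topology
  proof (intro conjI ballI)
    fix x assume "x \<in> topspace (path_topology UNIV) - path_space E s r"
    then obtain n where n: "\<not> (x n \<in> E n \<and> r n (x n) = s (Suc n) (x (Suc n)))"
      by (auto simp: path_space_def)
    have "y \<notin> path_space E s r" if "\<forall>i<Suc (Suc n). y i = x i" for y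
    proof -
      have "y n = x n" "y (Suc n) = x (Suc n)" using that by auto
      then show ?thesis using n unfolding path_space_def mem_Collect_eq by metis
    qed
    then show "\<exists>n. \<forall>y\<in>UNIV. (\<forall>i<n. y i = x i) \<longrightarrow> y \<in> topspace (path_topology UNIV) - path_space E s r"
      by auto
  qed auto
  ultimately show ?thesis
    using closed_compactin compact_space_subtopology unfolding path_topology_def by blast
qed

lemma continuous_map_path_topology:
  "continuous_map (path_topology P) (path_topology Q) f \<longleftrightarrow>
     f ` P \<subseteq> Q \<and> (\<forall>x\<in>P. \<forall>n. \<exists>m. \<forall>y\<in>P. (\<forall>i<m. y i = x i) \<longrightarrow> (\<forall>i<n. f y i = f x i))"
  (is "_ \<longleftrightarrow> ?R")
proof
  assume c: "continuous_map (path_topology P) (path_topology Q) f"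
  then have fP: "f ` P \<subseteq> Q" by (simp add: continuous_map)
  moreover have "\<exists>m. \<forall>y\<in>P. (\<forall>i<m. y i = x i) \<longrightarrow> (\<forall>i<n. f y i = f x i)" if x: "x \<in> P" for x n
  proof -
    have "openin (path_topology Q) {z \<in> Q. \<forall>i<n. z i = f x i}"
      unfolding openin_path_topology by (auto intro: exI[of _ n])
    with c have o: "openin (path_topology P) {y \<in> P. f y \<in> {z \<in> Q. \<forall>i<n. z i = f x i}}"
      by (auto simp: continuous_map)
    have "x \<in> {y \<in> P. f y \<in> {z \<in> Q. \<forall>i<n. z i = f x i}}" using x fP by auto
    with o obtain m where "\<forall>y\<in>P. (\<forall>i<m. y i = x i) \<longrightarrow> y \<in> {y \<in> P. f y \<in> {z \<in> Q. \<forall>i<n. z i = f x i}}"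
      unfolding openin_path_topology by blast
    then show ?thesis by (intro exI[of _ m]) simp
  qed
  ultimately show ?R by blast
next
  assume R: ?R
  have "openin (path_topology P) {x \<in> P. f x \<in> U}" if U: "openin (path_topology Q) U" for U
    unfolding openin_path_topology
  proof (intro conjI ballI)
    fix x assume x: "x \<in> {x \<in> P. f x \<in> U}"
    then obtain n where n: "\<And>z. z \<in> Q \<Longrightarrow> \<forall>i<n. z i = f x i \<Longrightarrow> z \<in> U"
      using U unfolding openin_path_topology by blast
    have "x \<in> P" using x by simp
    then obtain m where m: "\<forall>y\<in>P. (\<forall>i<m. y i = x i) \<longrightarrow> (\<forall>i<n. f y i = f x i)"
      using R by presburger
    have "f y \<in> U" if "y \<in> P" "\<forall>i<m. y i = x i" for y
      using n[of "f y"] m that R by auto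
    then show "\<exists>m. \<forall>y\<in>P. (\<forall>i<m. y i = x i) \<longrightarrow> y \<in> {x \<in> P. f x \<in> U}"
      by blast
  qed auto
  then show "continuous_map (path_topology P) (path_topology Q) f"
    using R by (simp add: continuous_map)
qed

text \<open>Finitely many of the cylinders supplied by \<open>loc\<close> cover \<open>P\<close>,
  and by monotonicity the largest of their depths serves everywhere.\<close>

lemma compact_path_topology_uniform_depth:
  assumes P: "compact_space (path_topology P)"
    and loc: "\<And>x. x \<in> P \<Longrightarrow> \<exists>n. \<forall>y\<in>P. (\<forall>i<n. y i = x i) \<longrightarrow> S n y"
    and mono: "\<And>m n y. m \<le> n \<Longrightarrow> y \<in> P \<Longrightarrow> S m y \<Longrightarrow> S n y"
  shows "\<exists>N. \<forall>y\<in>P. S N y"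
proof -
  obtain n where n: "\<And>x y. x \<in> P \<Longrightarrow> y \<in> P \<Longrightarrow> \<forall>i<n x. y i = x i \<Longrightarrow> S (n x) y"
    using loc by metis
  let ?C = "\<lambda>x. {y \<in> P. \<forall>i<n x. y i = x i}"
  have "openin (path_topology P) (?C x)" for x
    unfolding openin_path_topology by (auto intro: exI[of _ "n x"])
  then have "\<exists>F. finite F \<and> F \<subseteq> ?C ` P \<and> P \<subseteq> \<Union>F"
    using P[unfolded compact_space_alt, rule_format, of "?C ` P"] by auto
  then obtain G where G: "finite G" "G \<subseteq> P" "P \<subseteq> (\<Union>x\<in>G. ?C x)"
    by (metis (no_types, lifting) finite_subset_image)
  \<comment> \<open>The inserted 0 keeps \<open>Max\<close> meaningful when \<open>G\<close> is
    empty.\<close>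
  define N where "N = Max (insert 0 (n ` G))"
  have "S N y" if "y \<in> P" for y
  proof -
    obtain x where x: "x \<in> G" "y \<in> ?C x" using G(3) \<open>y \<in> P\<close> by blast
    then have "n x \<le> N" unfolding N_def using G by (intro Max_ge) auto
    then show ?thesis using mono[of "n x" N y] n[of x y] x G that by auto
  qed
  then show ?thesis by blast
qed

section \<open>Extremal paths and the Vershik map\<close>

locale bratteli_diagram =
  fixes V :: "nat \<Rightarrow> 'v set" and E :: "nat \<Rightarrow> 'e set"
    and s r :: "nat \<Rightarrow> 'e \<Rightarrow> 'v" and v0 :: 'v
  assumes diagram: "bratteli V E s r v0"
begin

abbreviation paths :: "(nat \<Rightarrow> 'e) set" where "paths \<equiv> path_space E s r"

abbreviation sites :: "(nat \<times> 'v) set" where "sites \<equiv> (SIGMA n:UNIV. V (Suc n))"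

abbreviation orders :: "nat \<times> 'v \<Rightarrow> 'e list set" where
  "orders i \<equiv> local_orders E r (fst i) (snd i)"

abbreviation orderings :: "(nat \<times> 'v \<Rightarrow> 'e list) set" where "orderings \<equiv> PiE sites orders"

lemma finite_V: "finite (V n)" and finite_E: "finite (E n)"
  and s_in_V: "e \<in> E n \<Longrightarrow> s n e \<in> V n" and r_in_V: "e \<in> E n \<Longrightarrow> r n e \<in> V (Suc n)"
  and ex_in_edge: "v \<in> V (Suc n) \<Longrightarrow> \<exists>e\<in>E n. r n e = v"
  and ex_out_edge: "v \<in> V n \<Longrightarrow> \<exists>e\<in>E n. s n e = v"
  using diagram by (auto simp: bratteli_def)

lemma finite_orders: "finite (orders i)"
proof (rule finite_subset)
  show "orders i \<subseteq> {l. set l \<subseteq> E (fst i) \<and> distinct l}" by (auto simp: local_orders_def)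
  show "finite {l. set l \<subseteq> E (fst i) \<and> distinct l}"
    using finite_subset_distinct[OF finite_E] by simp
qed

lemma orders_nonempty: "orders i \<noteq> {}"
proof -
  have "finite {e \<in> E (fst i). r (fst i) e = snd i}" using finite_E by simp
  from finite_distinct_list[OF this] show ?thesis by (auto simp: local_orders_def)
qed

lemma ord_measure_eq: "ord_measure V E r = PiM sites (\<lambda>i. uniform_count_measure (orders i))"
  by (simp add: ord_measure_def case_prod_beta')

lemma space_ord_measure: "space (ord_measure V E r) = orderings"
  by (simp add: ord_measure_eq space_PiM space_uniform_count_measure)

lemma prob_space_ord_measure: "prob_space (ord_measure V E r)"
  unfolding ord_measure_eq
  by (intro prob_space_PiM prob_space_uniform_count_measure finite_orders orders_nonempty)

lemma order_at:
  assumes "\<omega> \<in> orderings" "v \<in> V (Suc n)"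
  shows "distinct (\<omega> (n, v))" "set (\<omega> (n, v)) = {e \<in> E n. r n e = v}" "\<omega> (n, v) \<noteq> []"
proof -
  have "\<omega> (n, v) \<in> orders (n, v)" using assms by (auto simp: PiE_iff)
  then show *: "distinct (\<omega> (n, v))" "set (\<omega> (n, v)) = {e \<in> E n. r n e = v}"
    by (auto simp: local_orders_def)
  show "\<omega> (n, v) \<noteq> []" using * ex_in_edge[OF assms(2)] by auto
qed

section \<open>Paths with extremal initial segments\<close>

lemma path_edge: "x \<in> paths \<Longrightarrow> x n \<in> E n"
  and path_link: "x \<in> paths \<Longrightarrow> r n (x n) = s (Suc n) (x (Suc n))"
  by (auto simp: path_space_def)

lemma path_range: "x \<in> paths \<Longrightarrow> r n (x n) \<in> V (Suc n)"
  by (simp add: path_edge r_in_V)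

text \<open>Entries below \<open>n\<close> are arbitrary, so a single edge can be altered before the
  segment below it is rebuilt.\<close>

definition tail_path :: "nat \<Rightarrow> (nat \<Rightarrow> 'e) \<Rightarrow> bool" where
  "tail_path n x \<longleftrightarrow> (\<forall>i\<ge>n. x i \<in> E i \<and> r i (x i) = s (Suc i) (x (Suc i)))"

lemma tail_path_update:
  assumes "x \<in> paths" "e \<in> E n" "r n e = r n (x n)"
  shows "tail_path n (x(n := e))"
  using assms path_edge[OF assms(1)] path_link[OF assms(1)] by (auto simp: tail_path_def)

lemma ex_tail_path:
  assumes "e \<in> E n"
  shows "\<exists>x. tail_path n x \<and> x n = e"
proof -
  define nxt where "nxt i e = (SOME e'. e' \<in> E (Suc i) \<and> s (Suc i) e' = r i e)" for i e
  have nxt: "nxt i e \<in> E (Suc i) \<and> s (Suc i) (nxt i e) = r i e" if "e \<in> E i" for i e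
    unfolding nxt_def by (rule someI_ex) (use ex_out_edge r_in_V[OF that] in blast)
  define z where "z = rec_nat e (\<lambda>k. nxt (n + k))"
  have z: "z 0 = e" "z (Suc k) = nxt (n + k) (z k)" for k by (simp_all add: z_def)
  have zE: "z k \<in> E (n + k)" for k
    by (induction k) (use assms nxt in \<open>auto simp: z\<close>)
  have "tail_path n (\<lambda>i. z (i - n))"
    unfolding tail_path_def
  proof (intro allI impI)
    fix i assume "n \<le> i"
    then obtain k where i: "i = n + k" using le_Suc_ex by blast
    show "z (i - n) \<in> E i \<and> r i (z (i - n)) = s (Suc i) (z (Suc i - n))"
      using zE[of k] nxt[OF zE[of k]] by (simp add: i Suc_diff_le z)
  qed
  then show ?thesis by (intro exI[of _ "\<lambda>i. z (i - n)"]) (simp add: z)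
qed

text \<open>The parameter \<open>c\<close> is always \<^const>\<open>hd\<close> or \<^const>\<open>last\<close>, so that minimal and
  maximal paths are treated together.\<close>

definition extremal_below ::
  "('e list \<Rightarrow> 'e) \<Rightarrow> (nat \<times> 'v \<Rightarrow> 'e list) \<Rightarrow> nat \<Rightarrow> (nat \<Rightarrow> 'e) \<Rightarrow> bool" where
  "extremal_below c \<omega> n x \<longleftrightarrow> (\<forall>i<n. x i = c (\<omega> (i, r i (x i))))"

lemma extremal_below_mono: "extremal_below c \<omega> n x \<Longrightarrow> m \<le> n \<Longrightarrow> extremal_below c \<omega> m x"
  by (auto simp: extremal_below_def)

text \<open>The segment below \<open>n\<close> is built downward: the vertex at which the known part
  starts selects, through \<open>c\<close>, the edge that enters it.\<close>

lemma ex_path_extremal_below: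
  assumes w: "\<omega> \<in> orderings" and c: "\<And>l. l \<noteq> [] \<Longrightarrow> c l \<in> set l" and x: "tail_path n x"
  shows "\<exists>y\<in>paths. (\<forall>i\<ge>n. y i = x i) \<and> extremal_below c \<omega> n y"
  using x
proof (induction n arbitrary: x)
  case 0
  then show ?case by (intro bexI[of _ x]) (auto simp: path_space_def tail_path_def extremal_below_def)
next
  case (Suc n)
  define v where "v = s (Suc n) (x (Suc n))"
  define e where "e = c (\<omega> (n, v))"
  have v: "v \<in> V (Suc n)" using Suc.prems by (simp add: v_def tail_path_def s_in_V)
  then have e: "e \<in> E n" "r n e = v"
    using c[of "\<omega> (n, v)"] order_at[OF w v] by (auto simp: e_def)
  have "tail_path n (x(n := e))"
    using Suc.prems e by (auto simp: tail_path_def v_def Suc_le_eq)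
  from Suc.IH[OF this] obtain y where y: "y \<in> paths" "\<forall>i\<ge>n. y i = (x(n := e)) i" "extremal_below c \<omega> n y"
    by blast
  have "extremal_below c \<omega> (Suc n) y"
    using y e by (auto simp: extremal_below_def less_Suc_eq e_def[symmetric])
  then show ?case using y by (intro bexI[of _ y]) auto
qed

text \<open>An extremal edge is determined by its range, so the segment can be read backward from
  the vertex where it ends.\<close>

lemma extremal_below_unique:
  assumes "y \<in> paths" "z \<in> paths" "extremal_below c \<omega> n y" "extremal_below c \<omega> n z"
    "s n (y n) = s n (z n)" "i < n"
  shows "y i = z i"
  using assms
proof (induction n)
  case (Suc n)
  have "r n (y n) = r n (z n)" using Suc.prems by (simp add: path_link)
  moreover have "y n = c (\<omega> (n, r n (y n)))" "z n = c (\<omega> (n, r n (z n)))"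
    using Suc.prems by (auto simp: extremal_below_def)
  ultimately have "y n = z n" by metis
  then show ?case
    using Suc extremal_below_mono[of c \<omega> "Suc n" _ n] by (auto simp: less_Suc_eq)
qed simp

section \<open>The Vershik step away from extremal paths\<close>

lemma max_paths_iff: "x \<in> max_paths E s r \<omega> \<longleftrightarrow> x \<in> paths \<and> (\<forall>n. extremal_below last \<omega> n x)"
  and min_paths_iff: "x \<in> min_paths E s r \<omega> \<longleftrightarrow> x \<in> paths \<and> (\<forall>n. extremal_below hd \<omega> n x)"
  by (auto simp: max_paths_def min_paths_def extremal_below_def)

lemma ex_first_not_extremal:
  assumes "\<not> (\<forall>n. extremal_below c \<omega> n x)"
  shows "\<exists>k. extremal_below c \<omega> k x \<and> x k \<noteq> c (\<omega> (k, r k (x k)))"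
proof -
  have ex: "\<exists>k. x k \<noteq> c (\<omega> (k, r k (x k)))" using assms by (auto simp: extremal_below_def)
  show ?thesis
    using LeastI_ex[OF ex]
    by (intro exI[of _ "LEAST k. x k \<noteq> c (\<omega> (k, r k (x k)))"])
      (auto simp: extremal_below_def dest: not_less_Least)
qed

lemma first_not_extremal_unique:
  assumes "extremal_below c \<omega> k x" "x k \<noteq> c (\<omega> (k, r k (x k)))"
    "extremal_below c \<omega> l x" "x l \<noteq> c (\<omega> (l, r l (x l)))"
  shows "k = l"
  using assms by (metis extremal_below_def linorder_neqE_nat)

lemma succ_edge_nth:
  assumes "distinct l" "\<omega> (n, r n e) = l" "Suc i < length l" "l ! i = e"
  shows "succ_edge r \<omega> n e = l ! Suc i"
  unfolding succ_edge_def
proof (rule the_equality)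
  show "\<exists>i'. Suc i' < length (\<omega> (n, r n e)) \<and> \<omega> (n, r n e) ! i' = e \<and> \<omega> (n, r n e) ! Suc i' = l ! Suc i"
    using assms by blast
  fix e' assume "\<exists>i. Suc i < length (\<omega> (n, r n e)) \<and> \<omega> (n, r n e) ! i = e \<and> \<omega> (n, r n e) ! Suc i = e'"
  then show "e' = l ! Suc i"
    using assms by (metis Suc_lessD nth_eq_iff_index_eq)
qed

lemma vershik_step_iff:
  assumes "extremal_below last \<omega> k x" "x k \<noteq> last (\<omega> (k, r k (x k)))"
  shows "vershik_step E s r \<omega> x y \<longleftrightarrow> y \<in> paths \<and> extremal_below hd \<omega> k y \<and>
    y k = succ_edge r \<omega> k (x k) \<and> (\<forall>i>k. y i = x i)"
proof -
  have "(LEAST k. x k \<noteq> last (\<omega> (k, r k (x k)))) = k"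
    using assms by (intro Least_equality) (auto simp: extremal_below_def not_le[symmetric])
  then show ?thesis by (simp add: vershik_step_def extremal_below_def)
qed

lemma not_last_edge:
  assumes w: "\<omega> \<in> orderings" and x: "x \<in> paths" "x k \<noteq> last (\<omega> (k, r k (x k)))"
  obtains i where "Suc i < length (\<omega> (k, r k (x k)))" "\<omega> (k, r k (x k)) ! i = x k"
    "succ_edge r \<omega> k (x k) = \<omega> (k, r k (x k)) ! Suc i"
proof -
  let ?l = "\<omega> (k, r k (x k))"
  note l = order_at[OF w path_range[OF x(1), of k]]
  have "x k \<in> set ?l" using x l path_edge by auto
  then obtain i where i: "i < length ?l" "?l ! i = x k" by (auto simp: in_set_conv_nth)
  have "Suc i \<noteq> length ?l"
    using i x(2) l(3) by (metis diff_Suc_1 last_conv_nth)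
  then have "Suc i < length ?l" using i by simp
  then show ?thesis
    using that[of i] i(2) succ_edge_nth[of ?l \<omega> k "x k" i] l(1) by simp
qed

text \<open>The new edge is a successor, hence not first in its order; so level \<open>k\<close> can
  be recovered from the image, as its first non-minimal level.\<close>

lemma vershik_step_facts:
  assumes w: "\<omega> \<in> orderings" and x: "x \<in> paths" "extremal_below last \<omega> k x"
    "x k \<noteq> last (\<omega> (k, r k (x k)))" and y: "vershik_step E s r \<omega> x y"
  shows "r k (y k) = r k (x k)" "y k \<noteq> hd (\<omega> (k, r k (y k)))"
    "y \<in> paths" "extremal_below hd \<omega> k y" "y k = succ_edge r \<omega> k (x k)" "\<And>i. i > k \<Longrightarrow> y i = x i"
proof -
  let ?l = "\<omega> (k, r k (x k))"
  note l = order_at[OF w path_range[OF x(1), of k]]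
  obtain i where i: "Suc i < length ?l" "?l ! i = x k" "succ_edge r \<omega> k (x k) = ?l ! Suc i"
    using not_last_edge[OF w x(1) x(3)] .
  show *: "y \<in> paths" "extremal_below hd \<omega> k y" "y k = succ_edge r \<omega> k (x k)" "\<And>i. i > k \<Longrightarrow> y i = x i"
    using y vershik_step_iff[OF x(2) x(3)] by auto
  have "y k \<in> set ?l" using i * by simp
  then show rk: "r k (y k) = r k (x k)" using l by auto
  show "y k \<noteq> hd (\<omega> (k, r k (y k)))"
  proof -
    have "?l ! Suc i \<noteq> ?l ! 0" using i(1) nth_eq_iff_index_eq[OF l(1), of "Suc i" 0] l(3) by auto
    then show ?thesis using hd_conv_nth[OF l(3)] *(3) i(3) rk by metis
  qed
qed

lemma ex_vershik_step:
  assumes w: "\<omega> \<in> orderings" and x: "x \<in> paths" "x \<notin> max_paths E s r \<omega>"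
  shows "\<exists>y. vershik_step E s r \<omega> x y"
proof -
  obtain k where k: "extremal_below last \<omega> k x" "x k \<noteq> last (\<omega> (k, r k (x k)))"
    using x ex_first_not_extremal[of last \<omega> x] by (auto simp: max_paths_iff)
  let ?l = "\<omega> (k, r k (x k))"
  note l = order_at[OF w path_range[OF x(1), of k]]
  obtain i where i: "Suc i < length ?l" "?l ! i = x k" "succ_edge r \<omega> k (x k) = ?l ! Suc i"
    using not_last_edge[OF w x(1) k(2)] .
  define e where "e = succ_edge r \<omega> k (x k)"
  have "e \<in> set ?l" using i by (simp add: e_def)
  then have "tail_path k (x(k := e))" using l x by (intro tail_path_update) auto
  from ex_path_extremal_below[OF w _ this, of hd]
  obtain y where "y \<in> paths" "\<forall>i\<ge>k. y i = (x(k := e)) i" "extremal_below hd \<omega> k y" by auto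
  then have "vershik_step E s r \<omega> x y"
    unfolding vershik_step_iff[OF k] by (auto simp: e_def)
  then show ?thesis by blast
qed

text \<open>The level \<open>k\<close> is recovered from \<open>y\<close>, then the edge there from
  its successor, then the maximal segment below from the source of that edge.\<close>

lemma vershik_step_inj:
  assumes w: "\<omega> \<in> orderings" and x: "x \<in> paths" "x \<notin> max_paths E s r \<omega>"
    and x': "x' \<in> paths" "x' \<notin> max_paths E s r \<omega>"
    and y: "vershik_step E s r \<omega> x y" "vershik_step E s r \<omega> x' y"
  shows "x = x'"
proof -
  obtain k where k: "extremal_below last \<omega> k x" "x k \<noteq> last (\<omega> (k, r k (x k)))"
    using x ex_first_not_extremal[of last \<omega> x] by (auto simp: max_paths_iff)
  obtain k' where k': "extremal_below last \<omega> k' x'" "x' k' \<noteq> last (\<omega> (k', r k' (x' k')))"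
    using x' ex_first_not_extremal[of last \<omega> x'] by (auto simp: max_paths_iff)
  note f = vershik_step_facts[OF w x(1) k y(1)] and f' = vershik_step_facts[OF w x'(1) k' y(2)]
  have kk: "k' = k" using first_not_extremal_unique f f' by blast
  have above: "x i = x' i" if "i > k" for i using f(6) f'(6) that kk by metis
  have rr: "r k (x k) = r k (x' k)" using f(1) f'(1) kk by metis
  let ?l = "\<omega> (k, r k (x k))"
  note l = order_at[OF w path_range[OF x(1), of k]]
  obtain i where i: "Suc i < length ?l" "?l ! i = x k" "succ_edge r \<omega> k (x k) = ?l ! Suc i"
    using not_last_edge[OF w x(1) k(2)] .
  obtain i' where i': "Suc i' < length ?l" "?l ! i' = x' k" "succ_edge r \<omega> k (x' k) = ?l ! Suc i'"
    using not_last_edge[OF w x'(1), of k] k' kk rr by metis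
  have "?l ! Suc i = ?l ! Suc i'" using f(5) f'(5) i i' kk by metis
  then have "Suc i = Suc i'" using l(1) i i' nth_eq_iff_index_eq by blast
  then have at: "x k = x' k" using i i' by auto
  have "x i = x' i" if "i < k" for i
    using extremal_below_unique[OF x(1) x'(1) k(1)] k'(1) kk at that by auto
  with above at show ?thesis by (metis ext linorder_neqE_nat)
qed

text \<open>A preimage replaces the first non-minimal edge by its predecessor and follows maximal
  edges below it.\<close>

lemma vershik_step_surj:
  assumes w: "\<omega> \<in> orderings" and y: "y \<in> paths" "y \<notin> min_paths E s r \<omega>"
  shows "\<exists>x\<in>paths - max_paths E s r \<omega>. vershik_step E s r \<omega> x y"
proof -
  obtain k where k: "extremal_below hd \<omega> k y" "y k \<noteq> hd (\<omega> (k, r k (y k)))"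
    using y ex_first_not_extremal[of hd \<omega> y] by (auto simp: min_paths_iff)
  let ?l = "\<omega> (k, r k (y k))"
  note l = order_at[OF w path_range[OF y(1), of k]]
  have "y k \<in> set ?l" using y l path_edge by auto
  then obtain j where j: "j < length ?l" "?l ! j = y k" by (auto simp: in_set_conv_nth)
  have "j \<noteq> 0" using j(2) k(2) hd_conv_nth[OF l(3)] by metis
  then obtain i where i: "Suc i < length ?l" "?l ! Suc i = y k" using j by (cases j) auto
  define e where "e = ?l ! i"
  have "e \<in> set ?l" using i by (simp add: e_def)
  then have e: "e \<in> E k" "r k e = r k (y k)" using l by auto
  then have "tail_path k (y(k := e))" using y by (intro tail_path_update) auto
  from ex_path_extremal_below[OF w _ this, of last]
  obtain x where x: "x \<in> paths" "\<forall>i\<ge>k. x i = (y(k := e)) i" "extremal_below last \<omega> k x" by auto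
  have xk: "x k = e" using x by auto
  have "e \<noteq> last ?l"
    using i(1) nth_eq_iff_index_eq[OF l(1), of i "length ?l - 1"] l(3)
    by (auto simp: e_def last_conv_nth)
  then have nl: "x k \<noteq> last (\<omega> (k, r k (x k)))" using xk e by simp
  have "succ_edge r \<omega> k (x k) = y k"
    using succ_edge_nth[OF l(1) _ i(1) e_def[symmetric], of \<omega> k] i(2) xk e(2) by simp
  then have "vershik_step E s r \<omega> x y"
    unfolding vershik_step_iff[OF x(3) nl] using x y k by auto
  moreover have "x \<notin> max_paths E s r \<omega>" using nl by (auto simp: max_paths_def)
  ultimately show ?thesis using x by blast
qed

section \<open>Perfect orderings from unique extremal paths\<close>

lemma compact_paths: "compact_space (path_topology paths)"
  by (rule compact_space_path_space[OF finite_E])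

text \<open>A path other than \<open>z\<close> shows a non-extremal edge within a finite prefix, and
  compactness makes the depth uniform.\<close>

lemma unique_extremal_uniform_depth:
  assumes uniq: "\<And>x. x \<in> paths \<Longrightarrow> (\<forall>n. extremal_below c \<omega> n x) \<Longrightarrow> x = z"
  shows "\<exists>N. \<forall>y\<in>paths. extremal_below c \<omega> N y \<longrightarrow> (\<forall>i<n. y i = z i)"
proof (rule compact_path_topology_uniform_depth[OF compact_paths])
  fix x assume x: "x \<in> paths"
  show "\<exists>N. \<forall>y\<in>paths. (\<forall>i<N. y i = x i) \<longrightarrow> extremal_below c \<omega> N y \<longrightarrow> (\<forall>i<n. y i = z i)"
  proof (cases "\<forall>n. extremal_below c \<omega> n x")
    case True
    then have "x = z" using uniq x by blast
    then show ?thesis by blast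
  next
    case False
    then obtain k where "x k \<noteq> c (\<omega> (k, r k (x k)))" by (auto simp: extremal_below_def)
    then show ?thesis by (intro exI[of _ "Suc k"]) (auto simp: extremal_below_def)
  qed
qed (use extremal_below_mono in blast)

text \<open>Vershik steps match non-maximal paths with non-minimal ones, so sending
  \<open>xM\<close> to \<open>xm\<close> completes a bijection. Continuity is delicate only at
  \<open>xM\<close>, and a continuous bijection of a compact Hausdorff space is a
  homeomorphism.\<close>

lemma perfect_if_unique_extremal:
  assumes w: "\<omega> \<in> orderings" and mx: "max_paths E s r \<omega> = {xM}" and mn: "min_paths E s r \<omega> = {xm}"
  shows "perfect_ordering E s r \<omega>"
proof -
  define \<phi> where "\<phi> x = (if x = xM then xm else (SOME y. vershik_step E s r \<omega> x y))" for x
  have step: "vershik_step E s r \<omega> x (\<phi> x)" if "x \<in> paths" "x \<noteq> xM" for x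
    using someI_ex[OF ex_vershik_step[OF w that(1)]] that mx by (auto simp: \<phi>_def)
  have first: "\<exists>k. extremal_below last \<omega> k x \<and> x k \<noteq> last (\<omega> (k, r k (x k)))"
    if "x \<in> paths" "x \<noteq> xM" for x
    using ex_first_not_extremal[of last \<omega> x] that mx max_paths_iff[of x \<omega>] by blast
  have xm: "xm \<in> paths" using mn min_paths_iff[of xm \<omega>] by blast
  have xM: "xM \<in> paths" "\<And>n. extremal_below last \<omega> n xM" using mx max_paths_iff[of xM \<omega>] by blast+
  have \<phi>M: "\<phi> xM = xm" by (simp add: \<phi>_def)
  have facts: "\<phi> x \<in> paths" "\<phi> x \<noteq> xm" if x: "x \<in> paths" "x \<noteq> xM" for x
  proof -
    obtain k where k: "extremal_below last \<omega> k x" "x k \<noteq> last (\<omega> (k, r k (x k)))"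
      using first[OF x] by blast
    note f = vershik_step_facts[OF w x(1) k step[OF x]]
    show "\<phi> x \<in> paths" by (rule f)
    have "\<phi> x \<notin> min_paths E s r \<omega>" using f(2) by (auto simp: min_paths_def)
    then show "\<phi> x \<noteq> xm" using mn by auto
  qed
  have maps: "\<phi> ` paths \<subseteq> paths" using facts(1) \<phi>M xm by (metis image_subsetI)
  have surj: "\<phi> ` paths = paths"
  proof (intro equalityI maps subsetI)
    fix y assume y: "y \<in> paths"
    show "y \<in> \<phi> ` paths"
    proof (cases "y = xm")
      case True
      then show ?thesis using \<phi>M xM by blast
    next
      case False
      then obtain x where x: "x \<in> paths" "x \<notin> max_paths E s r \<omega>" "vershik_step E s r \<omega> x y"
        using vershik_step_surj[OF w y] mn by blast
      then have "x \<noteq> xM" using mx by auto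
      obtain k where k: "extremal_below last \<omega> k x" "x k \<noteq> last (\<omega> (k, r k (x k)))"
        using first[OF x(1) \<open>x \<noteq> xM\<close>] by blast
      note f = vershik_step_facts[OF w x(1) k x(3)]
        and g = vershik_step_facts[OF w x(1) k step[OF x(1) \<open>x \<noteq> xM\<close>]]
      \<comment> \<open>Any two Vershik images of \<open>x\<close> coincide, so the value chosen by
        \<open>SOME\<close> is \<open>y\<close>.\<close>
      have "\<phi> x i = y i" for i
      proof (cases i k rule: linorder_cases)
        case less
        have "s k (\<phi> x k) = s k (y k)" using f(5) g(5) by simp
        then show ?thesis using extremal_below_unique[OF g(3) f(3) g(4) f(4) _ less] by simp
      qed (use f g in auto)
      then have "\<phi> x = y" by blast
      then show ?thesis using x by blast
    qed
  qed
  have inj: "inj_on \<phi> paths"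
  proof (rule inj_onI)
    fix x x' assume x: "x \<in> paths" "x' \<in> paths" "\<phi> x = \<phi> x'"
    consider "x = xM" | "x' = xM" | "x \<noteq> xM" "x' \<noteq> xM" by blast
    then show "x = x'"
    proof cases
      case 1
      then show ?thesis using facts(2)[of x'] \<phi>M x by auto
    next
      case 2
      then show ?thesis using facts(2)[of x] \<phi>M x by auto
    next
      case 3
      then show ?thesis
        using vershik_step_inj[OF w x(1) _ x(2)] step[OF x(1)] step[OF x(2)] mx x(3) by auto
    qed
  qed
  have cont: "continuous_map (path_topology paths) (path_topology paths) \<phi>"
    unfolding continuous_map_path_topology
  proof (intro conjI ballI allI maps)
    fix x n assume x: "x \<in> paths"
    show "\<exists>m. \<forall>y\<in>paths. (\<forall>i<m. y i = x i) \<longrightarrow> (\<forall>i<n. \<phi> y i = \<phi> x i)"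
    proof (cases "x = xM")
      case True
      obtain N where N: "\<And>y. y \<in> paths \<Longrightarrow> extremal_below hd \<omega> N y \<Longrightarrow> \<forall>i<n. y i = xm i"
        using unique_extremal_uniform_depth[of hd \<omega> xm n] mn min_paths_iff by blast
      have "\<forall>i<n. \<phi> y i = xm i" if y: "y \<in> paths" "\<forall>i<N. y i = x i" for y
      proof (cases "y = xM")
        case False
        obtain k where k: "extremal_below last \<omega> k y" "y k \<noteq> last (\<omega> (k, r k (y k)))"
          using first[OF y(1) False] by blast
        \<comment> \<open>The first non-maximal edge of \<open>y\<close> comes after the
          \<open>N\<close> edges shared with \<open>xM\<close>, so the image starts with a long
          minimal segment and is close to \<open>xm\<close>.\<close>
        have "N \<le> k"
        proof (rule ccontr)
          assume "\<not> N \<le> k"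
          then have "y k = xM k" using y(2) True by simp
          then show False using k(2) xM(2)[of "Suc k"] by (simp add: extremal_below_def)
        qed
        then have "extremal_below hd \<omega> N (\<phi> y)"
          using vershik_step_facts(4)[OF w y(1) k step[OF y(1) False]] extremal_below_mono by blast
        then show ?thesis using N facts(1)[OF y(1) False] by blast
      qed (simp add: \<phi>M)
      then show ?thesis using True \<phi>M by auto
    next
      case False
      obtain k where k: "extremal_below last \<omega> k x" "x k \<noteq> last (\<omega> (k, r k (x k)))"
        using first[OF x False] by blast
      note f = vershik_step_facts[OF w x k step[OF x False]]
      \<comment> \<open>Agreement through index \<open>k\<close> fixes the first non-maximal level
        and the successor edge; below \<open>k\<close> the image is then forced, and above
        \<open>k\<close> it copies the path.\<close>
      have "\<phi> y i = \<phi> x i"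
        if y: "y \<in> paths" "\<forall>i<max n (Suc k). y i = x i" and i: "i < n" for y i
      proof -
        have eq: "y j = x j" if "j \<le> k" for j using that y(2) by auto
        have ky: "extremal_below last \<omega> k y" "y k \<noteq> last (\<omega> (k, r k (y k)))"
          using k eq by (auto simp: extremal_below_def)
        then have "y \<noteq> xM" using xM(2)[of "Suc k"] by (auto simp: extremal_below_def)
        note g = vershik_step_facts[OF w y(1) ky step[OF y(1) \<open>y \<noteq> xM\<close>]]
        have at: "\<phi> y k = \<phi> x k" using f(5) g(5) eq by simp
        show ?thesis
        proof (cases i k rule: linorder_cases)
          case less
          then show ?thesis using extremal_below_unique[OF g(3) f(3) g(4) f(4)] at by simp
        next
          case greater
          then show ?thesis using f(6) g(6) y(2) i by simp
        qed (use at in simp)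
      qed
      then show ?thesis by blast
    qed
  qed
  have "homeomorphic_map (path_topology paths) (path_topology paths) \<phi>"
    using continuous_imp_homeomorphic_map[OF cont compact_paths Hausdorff_space_path_topology] surj inj by simp
  moreover have "\<phi> ` max_paths E s r \<omega> = min_paths E s r \<omega>" using mx mn \<phi>M by simp
  ultimately show ?thesis
    unfolding perfect_ordering_def using step mx by (intro exI[of _ \<phi>]) auto
qed

section \<open>Reversal of all local orders\<close>

lemma reverse_orderings:
  defines "M \<equiv> ord_measure V E r" and "R \<equiv> \<lambda>\<omega>. \<lambda>i\<in>sites. rev (\<omega> i)"
  shows "R \<in> measurable M M" "distr M M R = M"
proof -
  have bij: "bij_betw rev (orders i) (orders i)" for i
    by (rule bij_betwI[where g = rev]) (simp_all add: local_orders_def Pi_def)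
  show "R \<in> measurable M M" "distr M M R = M"
    unfolding M_def R_def ord_measure_eq
    by (rule distr_PiM_uniform_bij[of sites orders "\<lambda>_. rev", OF finite_orders orders_nonempty bij])+
qed

lemma max_paths_reverse:
  assumes "\<omega> \<in> orderings"
  shows "max_paths E s r (\<lambda>i\<in>sites. rev (\<omega> i)) = min_paths E s r \<omega>"
proof -
  have "last ((\<lambda>i\<in>sites. rev (\<omega> i)) (n, r n (x n))) = hd (\<omega> (n, r n (x n)))" if "x \<in> paths" for x n
    using path_range[OF that] by (simp add: last_rev)
  then show ?thesis
    unfolding max_paths_def min_paths_def by (intro Collect_cong conj_cong refl) (simp only:)
qed

lemma AE_perfect_if_unique_max:
  assumes "measure (completion (ord_measure V E r)) (orderings_with_max V E s r 1) = 1"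
  shows "AE \<omega> in ord_measure V E r. perfect_ordering E s r \<omega>"
proof -
  let ?M = "ord_measure V E r"
  let ?R = "\<lambda>\<omega>. \<lambda>i\<in>sites. rev (\<omega> i)"
  interpret prob_space ?M by (rule prob_space_ord_measure)
  interpret C: prob_space "completion ?M" by (rule prob_space_completion)
  have ae: "AE \<omega> in ?M. \<exists>x. max_paths E s r \<omega> = {x}"
    using C.AE_prob_1[OF assms] unfolding AE_completion_iff
    by (rule AE_mp) (auto simp: orderings_with_max_def card_1_singleton_iff)
  \<comment> \<open>Invariance replaces the measure by its image under reversal, so the statement
    also holds at \<open>?R \<omega>\<close>, whose maximal paths are the minimal paths of
    \<open>\<omega>\<close>.\<close>
  then have "AE \<omega> in distr ?M ?M ?R. \<exists>x. max_paths E s r \<omega> = {x}"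
    by (simp only: reverse_orderings)
  then have "AE \<omega> in ?M. \<exists>x. max_paths E s r (?R \<omega>) = {x}"
    by (rule AE_distrD[OF reverse_orderings(1)])
  with ae AE_space[of ?M] show ?thesis
  proof eventually_elim
    case (elim \<omega>)
    then show ?case
      using perfect_if_unique_extremal[of \<omega>] max_paths_reverse[of \<omega>]
      by (auto simp: space_ord_measure)
  qed
qed

section \<open>Labels of perfect orderings\<close>

text \<open>This is the ancestor at level \<open>N\<close> of a vertex of level \<open>N + k\<close>
  along extremal edges. Orders at level \<open>Suc n\<close> are stored under index
  \<open>n\<close>, hence the index \<open>N + k\<close> in the step for
  \<open>Suc k\<close>.\<close>

primrec anc :: "('e list \<Rightarrow> 'e) \<Rightarrow> (nat \<times> 'v \<Rightarrow> 'e list) \<Rightarrow> nat \<Rightarrow> nat \<Rightarrow> 'v \<Rightarrow> 'v" where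
  "anc c \<omega> N 0 v = v"
| "anc c \<omega> N (Suc k) v = anc c \<omega> N k (s (N + k) (c (\<omega> (N + k, v))))"

text \<open>Only levels \<open>n \<ge> N\<close> are meant; below \<open>N\<close>, truncated
  subtraction leaves \<open>f\<close> itself.\<close>

definition label :: "('e list \<Rightarrow> 'e) \<Rightarrow> (nat \<times> 'v \<Rightarrow> 'e list) \<Rightarrow> nat \<Rightarrow> ('v \<Rightarrow> nat) \<Rightarrow> nat \<Rightarrow> 'v \<Rightarrow> nat" where
  "label c \<omega> N f n v = f (anc c \<omega> N (n - N) v)"

lemma label_base: "label c \<omega> N f N v = f v"
  by (simp add: label_def)

lemma label_Suc: "N \<le> n \<Longrightarrow> label c \<omega> N f (Suc n) v = label c \<omega> N f n (s n (c (\<omega> (n, v))))"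
  by (simp add: label_def Suc_diff_le)

lemma anc_cong:
  "(\<And>i v. i < N + k \<Longrightarrow> \<omega>' (i, v) = \<omega> (i, v)) \<Longrightarrow> anc c \<omega>' N k v = anc c \<omega> N k v"
  by (induction k arbitrary: v) auto

lemma label_cong:
  assumes "\<And>i v. i < n \<Longrightarrow> \<omega>' (i, v) = \<omega> (i, v)"
  shows "label c \<omega>' N f n v = label c \<omega> N f n v"
proof (cases "N \<le> n")
  case True
  then show ?thesis unfolding label_def using assms by (subst anc_cong[of N "n - N" \<omega>' \<omega>]) auto
qed (simp add: label_def)

text \<open>Read backward, an extremal segment is exactly the walk that computes the label.\<close>

lemma label_path:
  assumes x: "x \<in> paths" and N: "N \<le> n" and "extremal_below c \<omega> n x"
  shows "label c \<omega> N f n (s n (x n)) = f (s N (x N))"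
  using N assms(3)
proof (induction n rule: dec_induct)
  case base
  show ?case by (simp add: label_base)
next
  case (step n)
  have "c (\<omega> (n, s (Suc n) (x (Suc n)))) = x n"
    using step.prems path_link[OF x, of n] unfolding extremal_below_def by (metis lessI)
  then show ?case
    using step extremal_below_mono[of c \<omega> "Suc n" x n] by (simp add: label_Suc)
qed

definition fits :: "nat \<Rightarrow> ('v \<Rightarrow> nat) \<Rightarrow> ('v \<Rightarrow> nat) \<Rightarrow> (nat \<times> 'v \<Rightarrow> 'e list) \<Rightarrow> nat \<Rightarrow> 'e list \<Rightarrow> bool" where
  "fits N f g \<omega> n l \<longleftrightarrow>
     matching (\<lambda>e. label last \<omega> N f n (s n e)) (\<lambda>e. label hd \<omega> N g n (s n e)) l"

definition good :: "nat \<Rightarrow> ('v \<Rightarrow> nat) \<Rightarrow> ('v \<Rightarrow> nat) \<Rightarrow> (nat \<times> 'v \<Rightarrow> 'e list) \<Rightarrow> nat \<Rightarrow> bool" where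
  "good N f g \<omega> n \<longleftrightarrow> (\<forall>v\<in>V (Suc n). fits N f g \<omega> n (\<omega> (n, v))) \<and>
     (\<exists>u\<in>V n. \<exists>u'\<in>V n. label last \<omega> N f n u \<noteq> label last \<omega> N f n u')"

text \<open>Labels at level \<open>n\<close> read only orders of index below \<open>n\<close>, while
  the lists tested later are orders of index \<open>n\<close>. Hence a change at index
  \<open>n\<close> leaves the test itself unchanged.\<close>

lemma fits_cong:
  assumes "\<And>i v. i < n \<Longrightarrow> \<omega>' (i, v) = \<omega> (i, v)"
  shows "fits N f g \<omega>' n l \<longleftrightarrow> fits N f g \<omega> n l"
  unfolding fits_def by (simp add: label_cong[of n \<omega>' \<omega>] assms)

lemma good_cong:
  assumes "\<And>i v. i < Suc n \<Longrightarrow> \<omega>' (i, v) = \<omega> (i, v)"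
  shows "good N f g \<omega>' n \<longleftrightarrow> good N f g \<omega> n"
proof -
  have "label last \<omega>' N f n u = label last \<omega> N f n u" for u
    using assms by (intro label_cong) auto
  moreover have "fits N f g \<omega>' n l \<longleftrightarrow> fits N f g \<omega> n l" for l
    using assms by (intro fits_cong) auto
  ultimately show ?thesis using assms by (simp add: good_def)
qed

text \<open>The base labels are natural numbers on the finite set \<open>V N\<close> and fixed
  outside it, so only countably many triples \<open>(N, f, g)\<close> can arise.\<close>

lemma good_if_perfect:
  assumes w: "\<omega> \<in> orderings" and perf: "perfect_ordering E s r \<omega>"
    and x12: "x1 \<in> max_paths E s r \<omega>" "x2 \<in> max_paths E s r \<omega>" "x1 \<noteq> x2"
  shows "\<exists>N. \<exists>f\<in>V N \<rightarrow>\<^sub>E UNIV. \<exists>g\<in>V N \<rightarrow>\<^sub>E UNIV. \<forall>n\<ge>N. good N f g \<omega> n"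
proof -
  obtain \<phi> where homeo: "homeomorphic_map (path_topology paths) (path_topology paths) \<phi>"
      and step: "\<And>x. x \<in> paths \<Longrightarrow> x \<notin> max_paths E s r \<omega> \<Longrightarrow> vershik_step E s r \<omega> x (\<phi> x)"
    using perf by (auto simp: perfect_ordering_def)
  have p12: "x1 \<in> paths" "x2 \<in> paths" using x12 by (auto simp: max_paths_def)
  have "inj_on \<phi> paths" using homeomorphic_imp_injective_map[OF homeo] by simp
  then have "\<phi> x1 \<noteq> \<phi> x2" using p12 x12(3) by (auto dest: inj_onD)
  then obtain c where c: "\<phi> x1 c \<noteq> \<phi> x2 c" by auto
  have cont: "\<phi> ` paths \<subseteq> paths"
      "\<And>x n. x \<in> paths \<Longrightarrow> \<exists>m. \<forall>y\<in>paths. (\<forall>i<m. y i = x i) \<longrightarrow> (\<forall>i<n. \<phi> y i = \<phi> x i)"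
    using homeomorphic_imp_continuous_map[OF homeo] unfolding continuous_map_path_topology by blast+
  have "\<exists>N. \<forall>y\<in>paths. \<forall>z\<in>paths. (\<forall>i<N. z i = y i) \<longrightarrow> \<phi> z c = \<phi> y c"
  proof (rule compact_path_topology_uniform_depth[OF compact_paths])
    fix x assume "x \<in> paths"
    from cont(2)[OF this, of "Suc c"] obtain m
      where m: "\<And>y. y \<in> paths \<Longrightarrow> \<forall>i<m. y i = x i \<Longrightarrow> \<phi> y c = \<phi> x c" by blast
    have "\<phi> z c = \<phi> y c"
      if "y \<in> paths" "\<forall>i<m. y i = x i" "z \<in> paths" "\<forall>i<m. z i = y i" for y z
      using m[of y] m[of z] that by simp
    then show "\<exists>N. \<forall>y\<in>paths. (\<forall>i<N. y i = x i) \<longrightarrow> (\<forall>z\<in>paths. (\<forall>i<N. z i = y i) \<longrightarrow> \<phi> z c = \<phi> y c)"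
      by blast
  next
    fix m n y assume "m \<le> (n::nat)" "\<forall>z\<in>paths. (\<forall>i<m. z i = y i) \<longrightarrow> \<phi> z c = \<phi> y c"
    then show "\<forall>z\<in>paths. (\<forall>i<n. z i = y i) \<longrightarrow> \<phi> z c = \<phi> y c" by (meson order_less_le_trans)
  qed
  then obtain N0 where N0: "\<And>y z. y \<in> paths \<Longrightarrow> z \<in> paths \<Longrightarrow> \<forall>i<N0. z i = y i \<Longrightarrow> \<phi> z c = \<phi> y c"
    by blast
  \<comment> \<open>\<open>N0\<close> edges determine coordinate \<open>c\<close> of the image;
    \<open>Suc c\<close> places coordinate \<open>c\<close> itself inside the segment below level
    \<open>N\<close>.\<close>
  define N where "N = max N0 (Suc c)"
  obtain h :: "'e \<Rightarrow> nat" where h: "inj_on h (E c)"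
    using finite_imp_inj_to_nat_seg[OF finite_E] by blast
  define f where "f = (\<lambda>u\<in>V N. h (\<phi> (SOME x. x \<in> paths \<and> s N (x N) = u \<and> extremal_below last \<omega> N x) c))"
  define g where "g = (\<lambda>u\<in>V N. h ((SOME y. y \<in> paths \<and> s N (y N) = u \<and> extremal_below hd \<omega> N y) c))"
  have f: "f (s N (x N)) = h (\<phi> x c)" if x: "x \<in> paths" "extremal_below last \<omega> N x" for x
  proof -
    \<comment> \<open>The path chosen by \<open>SOME\<close> may differ from \<open>x\<close>, but
      its first \<open>N\<close> edges do not.\<close>
    define x' where "x' = (SOME x'. x' \<in> paths \<and> s N (x' N) = s N (x N) \<and> extremal_below last \<omega> N x')"
    have x': "x' \<in> paths \<and> s N (x' N) = s N (x N) \<and> extremal_below last \<omega> N x'"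
      unfolding x'_def by (rule someI[of _ x]) (use x in simp)
    then have "\<forall>i<N. x' i = x i"
      using extremal_below_unique[of x' x last \<omega> N] x by simp
    then have "\<phi> x' c = \<phi> x c" using N0[of x x'] x x' by (simp add: N_def)
    then show ?thesis using x by (simp add: f_def s_in_V path_edge x'_def)
  qed
  have g: "g (s N (y N)) = h (y c)" if y: "y \<in> paths" "extremal_below hd \<omega> N y" for y
  proof -
    define y' where "y' = (SOME y'. y' \<in> paths \<and> s N (y' N) = s N (y N) \<and> extremal_below hd \<omega> N y')"
    have y': "y' \<in> paths \<and> s N (y' N) = s N (y N) \<and> extremal_below hd \<omega> N y'"
      unfolding y'_def by (rule someI[of _ y]) (use y in simp)
    then have "y' c = y c" using extremal_below_unique[of y' y hd \<omega> N c] y by (simp add: N_def)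
    then show ?thesis using y by (simp add: g_def s_in_V path_edge y'_def)
  qed
  have "good N f g \<omega> n" if n: "N \<le> n" for n
    unfolding good_def
  proof (intro conjI ballI)
    have "label last \<omega> N f n (s n (x n)) = h (\<phi> x c)" if "x \<in> max_paths E s r \<omega>" for x
      using that label_path[of x N n last \<omega> f] f[of x] n by (simp add: max_paths_iff)
    moreover have "h (\<phi> x1 c) \<noteq> h (\<phi> x2 c)"
      using c h p12 cont(1) path_edge[of "\<phi> x1" c] path_edge[of "\<phi> x2" c] by (auto dest!: inj_onD)
    moreover have "s n (x1 n) \<in> V n" "s n (x2 n) \<in> V n" using p12 by (auto intro: s_in_V path_edge)
    ultimately show "\<exists>u\<in>V n. \<exists>u'\<in>V n. label last \<omega> N f n u \<noteq> label last \<omega> N f n u'"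
      using x12 by metis
  next
    fix v assume v: "v \<in> V (Suc n)"
    let ?l = "\<omega> (n, v)"
    note l = order_at[OF w v]
    show "fits N f g \<omega> n ?l"
      unfolding fits_def matching_def
    proof (intro allI impI)
      fix i assume i: "Suc i < length ?l"
      have e: "?l ! i \<in> E n" "r n (?l ! i) = v"
        using nth_mem[of i ?l] i l(2) by auto
      \<comment> \<open>A path through \<open>?l ! i\<close> with a maximal segment below has a
        known Vershik image, through \<open>?l ! Suc i\<close> with a minimal segment below; both
        labels therefore read coordinate \<open>c\<close> of the same image.\<close>
      obtain z where z: "tail_path n z" "z n = ?l ! i" using ex_tail_path[OF e(1)] by blast
      obtain x where x: "x \<in> paths" "\<forall>j\<ge>n. x j = z j" "extremal_below last \<omega> n x"
        using ex_path_extremal_below[OF w _ z(1), of last] by auto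
      have xn: "x n = ?l ! i" using x z by simp
      have "?l ! i \<noteq> ?l ! (length ?l - 1)"
        using nth_eq_iff_index_eq[OF l(1), of i "length ?l - 1"] i by auto
      then have nl: "x n \<noteq> last (\<omega> (n, r n (x n)))"
        using last_conv_nth[OF l(3)] xn e(2) by metis
      then have "x \<notin> max_paths E s r \<omega>" by (auto simp: max_paths_def)
      note y = vershik_step_facts[OF w x(1) x(3) nl step[OF x(1) this]]
      have yn: "\<phi> x n = ?l ! Suc i"
        using y(5) succ_edge_nth[OF l(1) _ i refl, of \<omega> n] xn e(2) by simp
      have "label last \<omega> N f n (s n (?l ! i)) = h (\<phi> x c)"
        using label_path[OF x(1) n x(3), of f] f[OF x(1) extremal_below_mono[OF x(3) n]] xn by simp
      moreover have "label hd \<omega> N g n (s n (?l ! Suc i)) = h (\<phi> x c)"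
        using label_path[OF y(3) n y(4), of g] g[OF y(3) extremal_below_mono[OF y(4) n]] yn by simp
      ultimately show "label last \<omega> N f n (s n (?l ! i)) = label hd \<omega> N g n (s n (?l ! Suc i))" by simp
    qed
  qed
  moreover have "f \<in> V N \<rightarrow>\<^sub>E UNIV" "g \<in> V N \<rightarrow>\<^sub>E UNIV" by (auto simp: f_def g_def)
  ultimately show ?thesis by blast
qed

section \<open>Labels inside a free window\<close>

lemma fin_path_Suc_cases:
  assumes "fin_path E s r n (Suc m) u v p"
  shows "p m \<in> E m" "r m (p m) = v"
    and "n = m \<and> u = s m (p m) \<or> n < m \<and> fin_path E s r n m u (s m (p m)) p"
proof -
  show "p m \<in> E m" "r m (p m) = v" using assms by (auto simp: fin_path_def)
  show "n = m \<and> u = s m (p m) \<or> n < m \<and> fin_path E s r n m u (s m (p m)) p"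
  proof (cases "n = m")
    case True
    then show ?thesis using assms by (auto simp: fin_path_def)
  next
    case False
    then have "n < m" using assms by (auto simp: fin_path_def)
    then have "r (m - 1) (p (m - 1)) = s (Suc (m - 1)) (p (Suc (m - 1)))"
      using assms unfolding fin_path_def by auto
    then show ?thesis using assms \<open>n < m\<close> by (auto simp: fin_path_def)
  qed
qed

text \<open>The recursion of \<open>label\<close> is separated from its base, so that the window
  argument does not mention \<open>N\<close>, \<open>f\<close> and \<open>g\<close>.\<close>

definition labelling :: "(nat \<times> 'v \<Rightarrow> 'e list) \<Rightarrow> (nat \<Rightarrow> 'v \<Rightarrow> nat) \<Rightarrow> (nat \<Rightarrow> 'v \<Rightarrow> nat) \<Rightarrow> nat \<Rightarrow> bool" where
  "labelling \<omega> F G a \<longleftrightarrow> (\<forall>n\<ge>a. \<forall>v. F (Suc n) v = F n (s n (last (\<omega> (n, v)))) \<and>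
     G (Suc n) v = G n (s n (hd (\<omega> (n, v)))))"

definition free_window :: "(nat \<Rightarrow> 'v \<Rightarrow> nat) \<Rightarrow> (nat \<Rightarrow> 'v \<Rightarrow> nat) \<Rightarrow> nat \<Rightarrow> nat \<Rightarrow> bool" where
  "free_window F G a b \<longleftrightarrow> (\<forall>n v l. a \<le> n \<longrightarrow> n < b \<longrightarrow> v \<in> V (Suc n) \<longrightarrow> l \<in> orders (n, v) \<longrightarrow>
     matching (\<lambda>e. F n (s n e)) (\<lambda>e. G n (s n e)) l)"

context
  fixes \<omega> and F G :: "nat \<Rightarrow> 'v \<Rightarrow> nat" and a b :: nat
  assumes w: "\<omega> \<in> orderings" and labelling: "labelling \<omega> F G a" and free: "free_window F G a b"
begin

lemma F_Suc: "a \<le> n \<Longrightarrow> F (Suc n) v = F n (s n (last (\<omega> (n, v))))"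
  and G_Suc: "a \<le> n \<Longrightarrow> G (Suc n) v = G n (s n (hd (\<omega> (n, v))))"
  using labelling by (simp_all add: labelling_def)

text \<open>Some order begins with \<open>e\<close> followed by \<open>e'\<close>, and in a free
  window that order matches.\<close>

lemma free_pair:
  assumes n: "a \<le> n" "n < b" and e: "e \<in> E n" "e' \<in> E n" "r n e = r n e'" "e \<noteq> e'"
  shows "F n (s n e) = G n (s n e')"
proof -
  have "finite ({e'' \<in> E n. r n e'' = r n e} - {e, e'})" using finite_E by simp
  from finite_distinct_list[OF this] obtain l
    where l: "set l = {e'' \<in> E n. r n e'' = r n e} - {e, e'}" "distinct l" by blast
  then have "e # e' # l \<in> orders (n, r n e)" using e by (auto simp: local_orders_def)
  then have "matching (\<lambda>e. F n (s n e)) (\<lambda>e. G n (s n e)) (e # e' # l)"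
    using free n r_in_V[OF e(1)] unfolding free_window_def by blast
  then show ?thesis
    unfolding matching_def by (auto dest: spec[of _ 0])
qed

lemma last_hd_edges:
  assumes "v \<in> V (Suc n)"
  shows "last (\<omega> (n, v)) \<in> E n" "r n (last (\<omega> (n, v))) = v"
    "hd (\<omega> (n, v)) \<in> E n" "r n (hd (\<omega> (n, v))) = v"
proof -
  note l = order_at[OF w assms]
  show "last (\<omega> (n, v)) \<in> E n" "r n (last (\<omega> (n, v))) = v"
    "hd (\<omega> (n, v)) \<in> E n" "r n (hd (\<omega> (n, v))) = v"
    using last_in_set[OF l(3)] hd_in_set[OF l(3)] l(2) by auto
qed

text \<open>Comparing \<open>e\<close> with any other edge in both orders gives all sources the same
  labels, in particular the sources of the last and the first edge.\<close>

lemma equal_labels_propagate: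
  assumes n: "a \<le> n" "n < b" and e: "e \<in> E n" "F n (s n e) = G n (s n e)"
  shows "F (Suc n) (r n e) = F n (s n e)" "G (Suc n) (r n e) = F n (s n e)"
proof -
  have others: "F n (s n e') = F n (s n e)" "G n (s n e') = F n (s n e)"
    if "e' \<in> E n" "r n e' = r n e" for e'
    using free_pair[OF n e(1) that(1)] free_pair[OF n that(1) e(1)] that e(2) by (cases "e' = e", auto)+
  show "F (Suc n) (r n e) = F n (s n e)" "G (Suc n) (r n e) = F n (s n e)"
    using others last_hd_edges[OF r_in_V[OF e(1)]] by (simp_all add: F_Suc[OF n(1)] G_Suc[OF n(1)])
qed

text \<open>With two edges the first and the last differ, and \<open>free_pair\<close>, applied to
  the last followed by the first, equates the labels that they pass to \<open>v\<close>.\<close>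

lemma unequal_labels_unique_edge:
  assumes n: "a \<le> n" "n < b" and e: "e \<in> E n" "e' \<in> E n" "r n e = v" "r n e' = v"
    and ne: "F (Suc n) v \<noteq> G (Suc n) v"
  shows "e = e'"
proof (rule ccontr)
  assume neq: "e \<noteq> e'"
  have v: "v \<in> V (Suc n)" using e r_in_V by blast
  note l = order_at[OF w v]
  have "e \<in> set (\<omega> (n, v))" "e' \<in> set (\<omega> (n, v))" using e l(2) by auto
  then have "hd (\<omega> (n, v)) \<noteq> last (\<omega> (n, v))"
    using l(1,3) neq by (cases "\<omega> (n, v)") (auto split: if_splits)
  then have "F n (s n (last (\<omega> (n, v)))) = G n (s n (hd (\<omega> (n, v))))"
    using last_hd_edges[OF v] by (intro free_pair[OF n]) auto
  then show False using ne by (simp add: F_Suc[OF n(1)] G_Suc[OF n(1)])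
qed

lemma equal_labels_path:
  assumes "fin_path E s r n m u v p" "a \<le> n" "m \<le> b" "F n u = G n u"
  shows "F m v = F n u \<and> G m v = F n u"
  using assms
proof (induction m arbitrary: v)
  case 0
  then show ?case by (simp add: fin_path_def)
next
  case (Suc m)
  note p = fin_path_Suc_cases[OF Suc.prems(1)]
  have *: "F m (s m (p m)) = F n u \<and> G m (s m (p m)) = F n u" "n \<le> m"
    using p(3) Suc.IH[of "s m (p m)"] Suc.prems by auto
  then show ?case
    using equal_labels_propagate[of m "p m"] p(1,2) Suc.prems by auto
qed

text \<open>Unequal labels force a single incoming edge, and its source again has unequal labels,
  since equality would propagate. So the backward walk has no choice.\<close>

lemma unequal_labels_unique_source:
  assumes "fin_path E s r n m u v p" "fin_path E s r n m u' v p'" "a \<le> n" "m \<le> b" "F m v \<noteq> G m v"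
  shows "u = u'"
  using assms
proof (induction m arbitrary: v)
  case 0
  then show ?case by (simp add: fin_path_def)
next
  case (Suc m)
  note p = fin_path_Suc_cases[OF Suc.prems(1)] and p' = fin_path_Suc_cases[OF Suc.prems(2)]
  have nm: "a \<le> m" "m < b" using p(3) Suc.prems by auto
  have eq: "p m = p' m"
    using unequal_labels_unique_edge[OF nm p(1) p'(1) p(2) p'(2)] Suc.prems by simp
  have "F m (s m (p m)) \<noteq> G m (s m (p m))"
    using equal_labels_propagate[OF nm p(1)] p(2) Suc.prems(5) by auto
  then show ?case
    using p(3) p'(3) eq Suc.IH[of "s m (p m)"] Suc.prems by auto
qed

end

text \<open>In a free window a vertex with two incoming edges gets equal labels \<^term>\<open>F\<close> and \<^term>\<open>G\<close>, and equal
  labels are copied along every path.  So after one full connection the two labels agree everywhere,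
  and after a second one the level in between carries a single label.\<close>

lemma ex_window:
  assumes simple: "simple_bratteli V E s r"
  shows "\<exists>b>a. \<forall>\<omega>\<in>orderings. \<forall>F G. labelling \<omega> F G a \<longrightarrow>
    (\<forall>n. a \<le> n \<and> n < b \<longrightarrow> (\<exists>u\<in>V n. \<exists>u'\<in>V n. F n u \<noteq> F n u')) \<longrightarrow> \<not> free_window F G a b"
proof -
  \<comment> \<open>Both \<open>m\<close> and \<open>b\<close> depend on \<open>a\<close> alone, so
    one window serves all orderings and labellings.\<close>
  obtain m where m: "a < m" "\<And>v v'. v \<in> V a \<Longrightarrow> v' \<in> V m \<Longrightarrow> \<exists>p. fin_path E s r a m v v' p"
    using simple unfolding simple_bratteli_def by blast
  obtain b where b: "m < b" "\<And>v v'. v \<in> V m \<Longrightarrow> v' \<in> V b \<Longrightarrow> \<exists>p. fin_path E s r m b v v' p"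
    using simple unfolding simple_bratteli_def by blast
  have "\<not> free_window F G a b"
    if w: "\<omega> \<in> orderings" and lab: "labelling \<omega> F G a"
      and split: "\<And>n. a \<le> n \<and> n < b \<Longrightarrow> \<exists>u\<in>V n. \<exists>u'\<in>V n. F n u \<noteq> F n u'"
    for \<omega> and F G :: "nat \<Rightarrow> 'v \<Rightarrow> nat"
  proof
    assume free: "free_window F G a b"
    obtain u u' where u: "u \<in> V a" "u' \<in> V a" "u \<noteq> u'" using split[of a] m b by auto
    have eq: "F m v = G m v" if v: "v \<in> V m" for v
    proof (rule ccontr)
      assume ne: "F m v \<noteq> G m v"
      obtain p p' where p: "fin_path E s r a m u v p" "fin_path E s r a m u' v p'"
        using m(2)[OF u(1) v] m(2)[OF u(2) v] by blast
      show False
        using unequal_labels_unique_source[OF w lab free p _ _ ne] u(3) b(1) by simp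
    qed
    obtain z where z: "z \<in> V b" using diagram unfolding bratteli_def by blast
    have "F m v = F b z" if v: "v \<in> V m" for v
    proof -
      obtain p where "fin_path E s r m b v z p" using b(2)[OF v z] by blast
      from equal_labels_path[OF w lab free this] eq[OF v] m(1) show ?thesis by simp
    qed
    then show False using split[of m] m(1) b(1) by auto
  qed
  moreover have "a < b" using m(1) b(1) by simp
  ultimately show ?thesis by blast
qed

section \<open>Decay of the probability of matching labels\<close>

text \<open>The form is the one of \<open>distr_PiM_uniform_bij\<close>, with the identity at every
  site but one.\<close>

definition flip :: "nat \<times> 'v \<times> 'e \<times> 'e \<Rightarrow> (nat \<times> 'v \<Rightarrow> 'e list) \<Rightarrow> nat \<times> 'v \<Rightarrow> 'e list" where
  "flip = (\<lambda>(n, v, e1, e2) \<omega>. \<lambda>i\<in>sites.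
     (if i = (n, v) then map (Transposition.transpose e1 e2) else id) (\<omega> i))"

definition flips :: "nat \<Rightarrow> (nat \<times> 'v \<times> 'e \<times> 'e) set" where
  "flips b = (SIGMA n:{..<b}. SIGMA v:V (Suc n). {e \<in> E n. r n e = v} \<times> {e \<in> E n. r n e = v})"

lemma finite_flips: "finite (flips b)"
  unfolding flips_def using finite_V finite_E by (intro finite_SigmaI) auto

lemma flip_facts:
  assumes t: "t \<in> flips b"
  defines "M \<equiv> ord_measure V E r"
  shows "flip t \<in> measurable M M" "distr M M (flip t) = M"
    "\<omega> \<in> orderings \<Longrightarrow> flip t (flip t \<omega>) = \<omega>" "\<omega> \<in> orderings \<Longrightarrow> flip t \<omega> \<in> orderings"
proof -
  obtain n v e1 e2 where t_eq: "t = (n, v, e1, e2)" by (cases t)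
  let ?f = "\<lambda>i. if i = (n, v) then map (Transposition.transpose e1 e2) else id"
  have e: "e1 \<in> E n" "r n e1 = v" "e2 \<in> E n" "r n e2 = v" using t by (auto simp: flips_def t_eq)
  have maps: "?f i l \<in> orders i" if "l \<in> orders i" for i l
  proof -
    have "Transposition.transpose e1 e2 ` {e \<in> E n. r n e = v} = {e \<in> E n. r n e = v}"
      using e by (intro transpose_image_eq) auto
    then show ?thesis
      using that by (auto simp: local_orders_def distinct_map)
  qed
  have invol: "?f i (?f i l) = l" for i l by (simp add: o_def)
  have bij: "bij_betw (?f i) (orders i) (orders i)" for i
    by (rule bij_betwI[where g = "?f i"]) (use maps invol in auto)
  have flip: "flip t = (\<lambda>\<omega>. \<lambda>i\<in>sites. ?f i (\<omega> i))" by (simp add: flip_def t_eq)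
  show "flip t \<in> measurable M M" "distr M M (flip t) = M"
    unfolding M_def flip ord_measure_eq
    by (rule distr_PiM_uniform_bij[of sites orders ?f, OF finite_orders orders_nonempty bij])+
  show "flip t \<omega> \<in> orderings" if "\<omega> \<in> orderings"
    unfolding flip restrict_PiE_iff by (intro ballI maps PiE_mem[OF that])
  show "flip t (flip t \<omega>) = \<omega>" if "\<omega> \<in> orderings"
  proof
    fix i show "flip t (flip t \<omega>) i = \<omega> i"
      using invol[of i "\<omega> i"] PiE_arb[OF that, of i] unfolding flip restrict_apply
      by (cases "i \<in> sites") presburger+
  qed
qed

lemma flip_below:
  assumes "\<omega> \<in> orderings" "i < n"
  shows "flip (n, v, e1, e2) \<omega> (i, u) = \<omega> (i, u)"
  using assms by (auto simp: flip_def PiE_iff extensional_def)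

text \<open>The transposition must spoil every fitting order, not only the current one, so that this
  property depends only on orders of index below \<open>n\<close>.\<close>

definition breaks ::
  "nat \<Rightarrow> ('v \<Rightarrow> nat) \<Rightarrow> ('v \<Rightarrow> nat) \<Rightarrow> (nat \<times> 'v \<Rightarrow> 'e list) \<Rightarrow> nat \<Rightarrow> 'v \<times> 'e \<times> 'e \<Rightarrow> bool" where
  "breaks N f g \<omega> n = (\<lambda>(v, e1, e2). v \<in> V (Suc n) \<and> e1 \<in> E n \<and> r n e1 = v \<and> e2 \<in> E n \<and> r n e2 = v \<and>
     (\<forall>l\<in>orders (n, v). fits N f g \<omega> n l \<longrightarrow> \<not> fits N f g \<omega> n (map (Transposition.transpose e1 e2) l)))"

text \<open>This is the key of the involution argument: it must be unchanged by the flip that it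
  selects.\<close>

definition first_flip ::
  "nat \<Rightarrow> ('v \<Rightarrow> nat) \<Rightarrow> ('v \<Rightarrow> nat) \<Rightarrow> nat \<Rightarrow> (nat \<times> 'v \<Rightarrow> 'e list) \<Rightarrow> nat \<times> 'v \<times> 'e \<times> 'e" where
  "first_flip N f g a \<omega> = (let n = LEAST n. a \<le> n \<and> (\<exists>t. breaks N f g \<omega> n t) in (n, SOME t. breaks N f g \<omega> n t))"

lemma breaks_cong:
  assumes "\<And>i v. i < n \<Longrightarrow> \<omega>' (i, v) = \<omega> (i, v)"
  shows "breaks N f g \<omega>' n t \<longleftrightarrow> breaks N f g \<omega> n t"
  by (simp add: breaks_def fits_cong[of n \<omega>' \<omega>] assms case_prod_beta)

lemma first_flip_breaks:
  assumes "\<exists>n t. a \<le> n \<and> n < b \<and> breaks N f g \<omega> n t" and t: "first_flip N f g a \<omega> = (n, t)"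
  shows "breaks N f g \<omega> n t" "a \<le> n" "n < b" "(n, t) \<in> flips b"
proof -
  let ?P = "\<lambda>n. a \<le> n \<and> (\<exists>t. breaks N f g \<omega> n t)"
  obtain m where m: "m < b" "?P m" using assms(1) by blast
  have n: "n = (LEAST n. ?P n)" "t = (SOME t. breaks N f g \<omega> n t)"
    using t by (auto simp: first_flip_def Let_def)
  then have P: "?P n" using LeastI[of ?P, OF m(2)] by simp
  then show br: "breaks N f g \<omega> n t" using n(2) by (simp add: someI_ex)
  show "a \<le> n" using P by blast
  show "n < b" using n(1) m Least_le[of ?P, OF m(2)] by simp
  with br show "(n, t) \<in> flips b" by (auto simp: breaks_def flips_def)
qed

text \<open>Up to level \<open>n\<close>, \<open>breaks\<close> reads only orders of index below
  \<open>n\<close>; so the least level stays the same and \<open>SOME\<close> is applied to the same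
  predicate.\<close>

lemma first_flip_cong:
  assumes "\<exists>n t. a \<le> n \<and> breaks N f g \<omega> n t" and t: "first_flip N f g a \<omega> = (n, t)"
    and eq: "\<And>i v. i < n \<Longrightarrow> \<omega>' (i, v) = \<omega> (i, v)"
  shows "first_flip N f g a \<omega>' = (n, t)"
proof -
  let ?P = "\<lambda>\<omega> n. a \<le> n \<and> (\<exists>t. breaks N f g \<omega> n t)"
  have br: "breaks N f g \<omega>' m t \<longleftrightarrow> breaks N f g \<omega> m t" if "m \<le> n" for m t
    using that eq by (intro breaks_cong) auto
  have n: "n = (LEAST n. ?P \<omega> n)" "t = (SOME t. breaks N f g \<omega> n t)"
    using t by (auto simp: first_flip_def Let_def)
  have ex: "\<exists>n. ?P \<omega> n" using assms(1) by blast
  have P: "?P \<omega> n" unfolding n(1) by (rule LeastI_ex[OF ex])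
  have "(LEAST n. ?P \<omega>' n) = n"
  proof (rule Least_equality)
    show "?P \<omega>' n" using P br by simp
    show "n \<le> m" if "?P \<omega>' m" for m
    proof (rule ccontr)
      assume "\<not> n \<le> m"
      then have "?P \<omega> m" using that br by simp
      then have "n \<le> m" unfolding n(1) by (rule Least_le)
      then show False using \<open>\<not> n \<le> m\<close> by simp
    qed
  qed
  moreover have "breaks N f g \<omega>' n = breaks N f g \<omega> n" using br by blast
  ultimately show ?thesis unfolding first_flip_def Let_def n(2) by simp
qed

section \<open>Halving over windows and the null set\<close>

definition good_upto :: "nat \<Rightarrow> ('v \<Rightarrow> nat) \<Rightarrow> ('v \<Rightarrow> nat) \<Rightarrow> nat \<Rightarrow> (nat \<times> 'v \<Rightarrow> 'e list) set" where
  "good_upto N f g b = {\<omega> \<in> orderings. \<forall>n. N \<le> n \<and> n < b \<longrightarrow> good N f g \<omega> n}"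

lemma sets_ord_measure_prefix:
  assumes "S \<subseteq> orderings"
    and "\<And>\<omega> \<omega>'. \<omega> \<in> S \<Longrightarrow> \<omega>' \<in> orderings \<Longrightarrow> (\<And>i v. i < b \<Longrightarrow> \<omega>' (i, v) = \<omega> (i, v)) \<Longrightarrow> \<omega>' \<in> S"
  shows "S \<in> sets (ord_measure V E r)"
  unfolding ord_measure_eq
proof (rule sets_PiM_uniform_finite_support)
  show "finite (SIGMA n:{..<b}. V (Suc n))" using finite_V by (intro finite_SigmaI) auto
  show "finite (orders i)" for i by (rule finite_orders)
  fix \<omega> \<omega>' assume w: "\<omega> \<in> S" "\<omega>' \<in> orderings" "\<And>i. i \<in> (SIGMA n:{..<b}. V (Suc n)) \<Longrightarrow> \<omega>' i = \<omega> i"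
  have "\<omega>' (i, v) = \<omega> (i, v)" if "i < b" for i v
  proof (cases "v \<in> V (Suc i)")
    \<comment> \<open>Outside the sites both orderings have the value
      \<open>undefined\<close>.\<close>
    case False
    then show ?thesis using w(2) subsetD[OF assms(1) w(1)] by (auto simp: PiE_iff extensional_def)
  qed (use w(3) that in auto)
  then show "\<omega>' \<in> S" using assms(2) w(1,2) by blast
qed (use assms in auto)

lemma good_upto_cong:
  assumes "\<omega> \<in> good_upto N f g b" "\<omega>' \<in> orderings" "\<And>i v. i < b \<Longrightarrow> \<omega>' (i, v) = \<omega> (i, v)"
  shows "\<omega>' \<in> good_upto N f g b"
proof -
  have "good N f g \<omega>' n" if "N \<le> n" "n < b" for n
    using assms that good_cong[of n \<omega>' \<omega> N f g] by (auto simp: good_upto_def)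
  then show ?thesis using assms by (simp add: good_upto_def)
qed

lemma good_upto_measurable: "good_upto N f g b \<in> sets (ord_measure V E r)"
proof (rule sets_ord_measure_prefix)
  show "good_upto N f g b \<subseteq> orderings" by (auto simp: good_upto_def)
qed (rule good_upto_cong)

text \<open>The first flip acts at a level \<open>n\<close> with \<open>a \<le> n\<close> and
  \<open>n < b\<close>: it keeps goodness below \<open>a\<close> and destroys it at
  \<open>n\<close>. So \<open>measure_le_half_by_involutions\<close> applies with
  \<open>first_flip\<close> as key.\<close>

lemma good_upto_halves:
  assumes simple: "simple_bratteli V E s r" and a: "N \<le> a"
  shows "\<exists>b>a. 2 * measure (ord_measure V E r) (good_upto N f g b) \<le> measure (ord_measure V E r) (good_upto N f g a)"
proof -
  let ?M = "ord_measure V E r"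
  interpret prob_space ?M by (rule prob_space_ord_measure)
  obtain b where b: "a < b" and win: "\<And>\<omega> F G. \<omega> \<in> orderings \<Longrightarrow> labelling \<omega> F G a \<Longrightarrow>
      (\<forall>n. a \<le> n \<and> n < b \<longrightarrow> (\<exists>u\<in>V n. \<exists>u'\<in>V n. F n u \<noteq> F n u')) \<Longrightarrow> \<not> free_window F G a b"
    using ex_window[OF simple, of a] by blast
  let ?A = "good_upto N f g b" and ?D = "good_upto N f g a" and ?key = "first_flip N f g a"
  have ex: "\<exists>n t. a \<le> n \<and> n < b \<and> breaks N f g \<omega> n t" if A: "\<omega> \<in> ?A" for \<omega>
  proof -
    let ?F = "label last \<omega> N f" and ?G = "label hd \<omega> N g"
    have w: "\<omega> \<in> orderings" using A by (simp add: good_upto_def)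
    have "labelling \<omega> ?F ?G a" using a by (auto simp: labelling_def label_Suc)
    moreover have "\<forall>n. a \<le> n \<and> n < b \<longrightarrow> (\<exists>u\<in>V n. \<exists>u'\<in>V n. ?F n u \<noteq> ?F n u')"
      using A a by (auto simp: good_upto_def good_def)
    \<comment> \<open>The window rules out that all orders match, so some order fails at some level,
      and a breaking transposition exists there.\<close>
    ultimately have "\<not> free_window ?F ?G a b" using win w by blast
    then obtain n v l where n: "a \<le> n" "n < b" "v \<in> V (Suc n)" "l \<in> orders (n, v)"
        "\<not> matching (\<lambda>e. ?F n (s n e)) (\<lambda>e. ?G n (s n e)) l"
      unfolding free_window_def by blast
    then have l: "distinct l" "set l = {e \<in> E n. r n e = v}" by (auto simp: local_orders_def)
    from ex_transpose_not_matching[OF l(1) n(5)] obtain e1 e2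
      where "e1 \<in> set l" "e2 \<in> set l"
        "\<forall>l'. distinct l' \<longrightarrow> set l' = set l \<longrightarrow> matching (\<lambda>e. ?F n (s n e)) (\<lambda>e. ?G n (s n e)) l' \<longrightarrow>
          \<not> matching (\<lambda>e. ?F n (s n e)) (\<lambda>e. ?G n (s n e)) (map (Transposition.transpose e1 e2) l')"
      by blast
    then have "breaks N f g \<omega> n (v, e1, e2)"
      using l n(3) by (simp add: breaks_def fits_def local_orders_def)
    then show ?thesis using n by blast
  qed
  have key: "\<exists>n v e1 e2. ?key \<omega> = (n, v, e1, e2)" for \<omega> by (metis prod_cases4)
  have agree: "?key \<omega>' = ?key \<omega>"
    if "\<omega> \<in> ?A" "\<And>i v. i < fst (?key \<omega>) \<Longrightarrow> \<omega>' (i, v) = \<omega> (i, v)" for \<omega> \<omega>'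
    using first_flip_cong[of a N f g \<omega> "fst (?key \<omega>)" "snd (?key \<omega>)" \<omega>'] ex[OF that(1)] that(2) by auto
  have "2 * measure ?M ?A \<le> measure ?M ?D"
  proof (rule measure_le_half_by_involutions[where K = "flips b" and \<tau> = flip and key = ?key])
    show "finite (flips b)" by (rule finite_flips)
    show "?A \<in> sets ?M" "?D \<in> sets ?M" by (rule good_upto_measurable)+
    show "?A \<subseteq> ?D" using b by (auto simp: good_upto_def)
    fix t assume t: "t \<in> flips b"
    show "flip t \<in> measurable ?M ?M" "distr ?M ?M (flip t) = ?M"
      using flip_facts(1,2)[OF t] .
    show "flip t (flip t \<omega>) = \<omega>" if "\<omega> \<in> space ?M" for \<omega>
      using flip_facts(3)[OF t] that by (simp add: space_ord_measure)
    show "{\<omega> \<in> ?A. ?key \<omega> = t} \<in> sets ?M"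
    proof (rule sets_ord_measure_prefix[of _ b])
      show "{\<omega> \<in> ?A. ?key \<omega> = t} \<subseteq> orderings" by (auto simp: good_upto_def)
      fix \<omega> \<omega>' assume *: "\<omega> \<in> {\<omega> \<in> ?A. ?key \<omega> = t}" "\<omega>' \<in> orderings"
        "\<And>i v. i < b \<Longrightarrow> \<omega>' (i, v) = \<omega> (i, v)"
      have "fst (?key \<omega>) < b"
        using first_flip_breaks(3)[OF ex, of \<omega> "fst (?key \<omega>)" "snd (?key \<omega>)"] *(1) by simp
      then have "?key \<omega>' = ?key \<omega>" using * by (intro agree) auto
      moreover have "\<omega>' \<in> ?A" using good_upto_cong[of \<omega> N f g b \<omega>'] * by blast
      ultimately show "\<omega>' \<in> {\<omega> \<in> ?A. ?key \<omega> = t}" using *(1) by auto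
    qed
  next
    fix \<omega> assume A: "\<omega> \<in> ?A"
    then have w: "\<omega> \<in> orderings" by (simp add: good_upto_def)
    obtain n v e1 e2 where t: "?key \<omega> = (n, v, e1, e2)" using key by blast
    note br = first_flip_breaks[OF ex[OF A] t]
    show "?key \<omega> \<in> flips b" using br(4) t by simp
    let ?w = "flip (n, v, e1, e2) \<omega>"
    have below: "?w (i, u) = \<omega> (i, u)" if "i < n" for i u
      using flip_below[OF w that] .
    have w': "?w \<in> orderings" using flip_facts(4)[OF br(4) w] .
    show "?key (flip (?key \<omega>) \<omega>) = ?key \<omega>"
      unfolding t[symmetric] using below agree[OF A] t by simp
    have v: "v \<in> V (Suc n)" using br(1) by (auto simp: breaks_def)
    have "fits N f g \<omega> n (\<omega> (n, v))"
      using A v br(2,3) a by (auto simp: good_upto_def good_def)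
    moreover have "\<omega> (n, v) \<in> orders (n, v)" using w v by (auto simp: PiE_iff)
    ultimately have "\<not> fits N f g \<omega> n (map (Transposition.transpose e1 e2) (\<omega> (n, v)))"
      using br(1) by (auto simp: breaks_def)
    moreover have "?w (n, v) = map (Transposition.transpose e1 e2) (\<omega> (n, v))"
      using v by (simp add: flip_def)
    \<comment> \<open>The flip does not change the labels at level \<open>n\<close>, so the
      transposed order fails for \<open>?w\<close> as well.\<close>
    ultimately have "\<not> fits N f g ?w n (?w (n, v))"
      using fits_cong[of n ?w \<omega>] below by simp
    then have "\<not> good N f g ?w n" using v by (auto simp: good_def)
    then have "?w \<notin> ?A" using br(2,3) a unfolding good_upto_def by fastforce
    moreover have "?w \<in> ?D"
    proof (rule good_upto_cong[of \<omega>])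
      show "\<omega> \<in> ?D" using A b by (auto simp: good_upto_def)
    qed (use w' below br(2) in auto)
    ultimately show "flip (?key \<omega>) \<omega> \<in> ?D - ?A" using t by simp
  qed
  then show ?thesis using b by blast
qed

text \<open>Each new window starts where the previous one ended, which gives geometric
  decay.\<close>

lemma good_forever_null:
  assumes simple: "simple_bratteli V E s r"
  shows "{\<omega> \<in> orderings. \<forall>n\<ge>N. good N f g \<omega> n} \<in> null_sets (ord_measure V E r)"
proof -
  let ?M = "ord_measure V E r" and ?S = "{\<omega> \<in> orderings. \<forall>n\<ge>N. good N f g \<omega> n}"
  interpret prob_space ?M by (rule prob_space_ord_measure)
  have "?S = (\<Inter>b. good_upto N f g b)"
    unfolding good_upto_def by (auto simp del: split_paired_All)
  then have S: "?S \<in> sets ?M" using good_upto_measurable by auto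
  have decay: "\<exists>b\<ge>N. prob (good_upto N f g b) \<le> (1 / 2) ^ k" for k
  proof (induction k)
    case 0
    then show ?case using prob_le_1 by auto
  next
    case (Suc k)
    then obtain a where a: "N \<le> a" "prob (good_upto N f g a) \<le> (1 / 2) ^ k" by blast
    then obtain b where "a < b" "2 * prob (good_upto N f g b) \<le> prob (good_upto N f g a)"
      using good_upto_halves[OF simple a(1)] by blast
    then show ?case using a by (intro exI[of _ b]) auto
  qed
  have le: "prob ?S \<le> (1 / 2) ^ k" for k
  proof -
    obtain b where b: "prob (good_upto N f g b) \<le> (1 / 2) ^ k" using decay by blast
    have "prob ?S \<le> prob (good_upto N f g b)"
      by (rule finite_measure_mono[OF _ good_upto_measurable]) (auto simp: good_upto_def)
    with b show ?thesis by simp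
  qed
  have "(\<lambda>k. (1 / 2 :: real) ^ k) \<longlonglongrightarrow> 0" by (rule LIMSEQ_realpow_zero) auto
  then have "prob ?S \<le> 0" by (rule LIMSEQ_le_const) (use le in auto)
  then have "emeasure ?M ?S = 0" unfolding emeasure_eq_measure by (rule ennreal_neg)
  then show ?thesis using S by (rule null_setsI)
qed

text \<open>The exceptional orderings lie in a countable union, over the triples
  \<open>(N, f, g)\<close>, of the null sets of \<open>good_forever_null\<close>.\<close>

lemma AE_not_perfect_if_two_max:
  assumes simple: "simple_bratteli V E s r"
  shows "AE \<omega> in ord_measure V E r. perfect_ordering E s r \<omega> \<longrightarrow>
    (\<forall>x\<in>max_paths E s r \<omega>. \<forall>y\<in>max_paths E s r \<omega>. x = y)"
proof (rule AE_I')
  let ?S = "\<Union>(N, f, g) \<in> (SIGMA N:UNIV. (V N \<rightarrow>\<^sub>E UNIV) \<times> (V N \<rightarrow>\<^sub>E UNIV)).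
    {\<omega> \<in> orderings. \<forall>n\<ge>N. good N f g \<omega> n}"
  have "countable (SIGMA N:UNIV. (V N \<rightarrow>\<^sub>E (UNIV :: nat set)) \<times> (V N \<rightarrow>\<^sub>E (UNIV :: nat set)))"
    using finite_V by (intro countable_SIGMA countable_PiE) auto
  then show "?S \<in> null_sets (ord_measure V E r)"
    using good_forever_null[OF simple] by (intro null_sets_UN') auto
  show "{\<omega> \<in> space (ord_measure V E r). \<not> (perfect_ordering E s r \<omega> \<longrightarrow>
      (\<forall>x\<in>max_paths E s r \<omega>. \<forall>y\<in>max_paths E s r \<omega>. x = y))} \<subseteq> ?S"
  proof
    fix \<omega> assume *: "\<omega> \<in> {\<omega> \<in> space (ord_measure V E r). \<not> (perfect_ordering E s r \<omega> \<longrightarrow>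
      (\<forall>x\<in>max_paths E s r \<omega>. \<forall>y\<in>max_paths E s r \<omega>. x = y))}"
    then have w: "\<omega> \<in> orderings" by (simp add: space_ord_measure)
    from * have perf: "perfect_ordering E s r \<omega>" by simp
    from * obtain x y where "x \<in> max_paths E s r \<omega>" "y \<in> max_paths E s r \<omega>" "x \<noteq> y" by auto
    from good_if_perfect[OF w perf this] obtain N f g
      where "f \<in> V N \<rightarrow>\<^sub>E UNIV" "g \<in> V N \<rightarrow>\<^sub>E UNIV" "\<forall>n\<ge>N. good N f g \<omega> n" by blast
    then have "(N, f, g) \<in> (SIGMA N:UNIV. (V N \<rightarrow>\<^sub>E UNIV) \<times> (V N \<rightarrow>\<^sub>E UNIV))"
        "\<omega> \<in> {\<omega> \<in> orderings. \<forall>n\<ge>N. good N f g \<omega> n}"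
      using w by simp_all
    then show "\<omega> \<in> ?S" by blast
  qed
qed

end

section \<open>Transfer to the completed measure\<close>

theorem mainTheorem20:
  fixes V :: "nat \<Rightarrow> 'v set" and E :: "nat \<Rightarrow> 'e set"
    and s r :: "nat \<Rightarrow> 'e \<Rightarrow> 'v" and v0 :: 'v
  assumes "bratteli V E s r v0"
    and "aperiodic E s r"
    and "simple_bratteli V E s r"
    and "finite_rank V"
  shows "(measure (completion (ord_measure V E r)) (orderings_with_max V E s r 1) = 1 \<longrightarrow>
            measure (completion (ord_measure V E r)) (perfect_orderings V E s r) = 1)
       \<and> (\<forall>j>1. measure (completion (ord_measure V E r)) (orderings_with_max V E s r j) = 1 \<longrightarrow>
            perfect_orderings V E s r \<in> null_sets (completion (ord_measure V E r)))"
proof -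
  interpret bratteli_diagram V E s r v0 by standard fact
  let ?M = "ord_measure V E r"
  interpret prob_space ?M by (rule prob_space_ord_measure)
  interpret C: prob_space "completion ?M" by (rule prob_space_completion)
  have sub: "perfect_orderings V E s r \<subseteq> space (completion ?M)" by (auto simp: perfect_orderings_def)
  show ?thesis
  proof (intro conjI allI impI)
    assume "measure (completion ?M) (orderings_with_max V E s r 1) = 1"
    then have "AE \<omega> in completion ?M. perfect_ordering E s r \<omega>"
      using AE_perfect_if_unique_max by (simp add: AE_completion_iff)
    then have ae: "AE \<omega> in completion ?M. \<omega> \<in> perfect_orderings V E s r"
      by (rule AE_mp) (auto simp: perfect_orderings_def)
    \<comment> \<open>This yields measurability: in the completion, a set that agrees almost
      everywhere with the whole space is measurable.\<close>
    then have "AE \<omega> in completion ?M. \<omega> \<in> space (completion ?M) \<longleftrightarrow> \<omega> \<in> perfect_orderings V E s r"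
      using AE_space by eventually_elim simp
    then have "perfect_orderings V E s r \<in> sets (completion ?M)"
      using completion.in_sets_AE[OF _ sets.top sub] by simp
    then show "measure (completion ?M) (perfect_orderings V E s r) = 1"
      using C.prob_eq_1 ae by blast
  next
    fix j :: nat assume j: "1 < j" and "measure (completion ?M) (orderings_with_max V E s r j) = 1"
    then have "AE \<omega> in completion ?M. \<omega> \<in> orderings_with_max V E s r j" by (intro C.AE_prob_1)
    moreover have "AE \<omega> in completion ?M. perfect_ordering E s r \<omega> \<longrightarrow>
        (\<forall>x\<in>max_paths E s r \<omega>. \<forall>y\<in>max_paths E s r \<omega>. x = y)"
      using AE_not_perfect_if_two_max assms(3) by (simp only: AE_completion_iff)
    ultimately have "AE \<omega> in completion ?M. \<omega> \<notin> perfect_orderings V E s r"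
    proof eventually_elim
      case (elim \<omega>)
      then have "\<not> card (max_paths E s r \<omega>) \<le> Suc 0" "finite (max_paths E s r \<omega>)"
        using j by (auto simp: orderings_with_max_def)
      then show ?case using elim(2) by (auto simp: perfect_orderings_def card_le_Suc0_iff_eq)
    qed
    then show "perfect_orderings V E s r \<in> null_sets (completion ?M)"
      using completion.null_sets_iff_AE sub by blast
  qed
qed

end
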